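(* Let $n\log n\ll m(n)\le 2^n$ and let $B_n\subset\mathcal V_n$ be such that $$0<|B_n|=2^n m(n)^{-1}(1+o(1)).$$ Define $$v_n(k)=\max_{x\in\mathcal V_n}\big|\{y\in B_n:d(x,y)=k\}\big|,\qquad V_n(k)=\max_{x\in\mathcal V_n}\big|\{y\in B_n:d(x,y)\le k\}\big|.$$ If there exists a function $g(n)$ such that $g(n)\le n/2$, $$\xi_n(g(n))\ll 2^{-n}m(n),$$ and $$\lim_{n\to\infty}\sum_{k=1}^{g(n)-1}v_n(k)\,\xi_n(k)=0\qquad\text{and}\qquad V_n(g(n)-1)\ll|B_n|,$$ then, for all $a>0$, $$\lim_{n\to\infty}\max_{x\in\mathcal V_n}\Big|\mathbb P_x\big[H_n(B_n\setminus x)\ge a\,m(n)\big]-e^{-a}\Big|=0.$$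
   Context: $\mathcal V_n=\{0,1\}^n$ is the $n$-dimensional hypercube with metric $d(x,y)=\sum_{i=1}^n \mathbf 1\{x(i)\ne y(i)\}$. $Y_n$ is the discrete-time simple random walk on $\mathcal V_n$: it has transition probabilities $\mathbb P[Y_n(k+1)=y\mid Y_n(k)=x]=n^{-1}$ if $d(x,y)=1$ and $0$ otherwise; $\mathbb P_x$ is its law conditioned on $Y_n(0)=x$. For $A\subset\mathcal V_n$, the hitting time is $H_n(A)=\min\{k\ge 0: Y_n(k)\in A\}$. $A\setminus x$ means $A\setminus\{x\}$. The function $\xi_n$ is $$\xi_n(k)=2^{-n}\frac n2\binom nk^{-1}\sum_{j=1}^{n-k}\binom n{k+j}\frac1j,\qquad k=0,\dots,n,$$ so that the values $g(n)$ are integers in $\{0,\dots,n\}$. For non-negative $u(n)$ and positive $v(n)$, $u(n)\ll v(n)$ means $u(n)/v(n)\to0$ as $n\to\infty$. *)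

theory Defs
  imports "HOL-Probability.Probability"
begin

type_synonym vertex = "nat \<Rightarrow> nat"

definition hypercube :: "nat \<Rightarrow> vertex set" where
  "hypercube n = {1..n} \<rightarrow>\<^sub>E {0, 1}"

definition hdist :: "nat \<Rightarrow> vertex \<Rightarrow> vertex \<Rightarrow> nat" where
  "hdist n x y = card {i \<in> {1..n}. x i \<noteq> y i}"

definition srw_step :: "nat \<Rightarrow> vertex \<Rightarrow> vertex pmf" where
  "srw_step n x = pmf_of_set {y \<in> hypercube n. hdist n x y = 1}"

text \<open>Distribution of the position at time \<open>i\<close>, given the positions \<open>\<omega> 0, \<dots>, \<omega> (i - 1)\<close>.\<close>

definition srw_kernel :: "nat \<Rightarrow> vertex \<Rightarrow> nat \<Rightarrow> (nat \<Rightarrow> vertex) \<Rightarrow> vertex measure" where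
  "srw_kernel n x i \<omega> =
     measure_pmf (case i of 0 \<Rightarrow> return_pmf x | Suc j \<Rightarrow> srw_step n (\<omega> j))"

text \<open>The law \<open>\<bbbP>\<^sub>x\<close> of the walk started at \<open>x\<close>, as the Ionescu-Tulcea measure on the space of
  trajectories \<open>\<omega>\<close>; the walk itself is the coordinate process, \<open>Y\<^sub>n(k) = \<omega> k\<close>. The finite-dimensional
  distributions and the transition probabilities are computed in \<open>measure_srw_cylinder\<close>,
  \<open>srw_transition\<close> and \<open>pmf_srw_step\<close> below.
  In dimension \<open>n = 0\<close>, where no walk exists, this is an unspecified probability measure.\<close>

definition srw_law :: "nat \<Rightarrow> vertex \<Rightarrow> (nat \<Rightarrow> vertex) measure" where
  "srw_law n x = projective_family.lim UNIV
     (Ionescu_Tulcea.CI (srw_kernel n x) (\<lambda>_. count_space UNIV)) (\<lambda>_. count_space UNIV)"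

text \<open>The value is \<open>\<infinity>\<close> on trajectories that never visit \<open>A\<close>.\<close>

definition hitting_time :: "vertex set \<Rightarrow> (nat \<Rightarrow> vertex) \<Rightarrow> enat" where
  "hitting_time A \<omega> = (INF k\<in>{k. \<omega> k \<in> A}. enat k)"

definition xi :: "nat \<Rightarrow> nat \<Rightarrow> real" where
  "xi n k = 1 / 2 ^ n * (real n / 2) * (1 / real (n choose k)) *
     (\<Sum>j = 1..n - k. real (n choose (k + j)) * (1 / real j))"

definition max_sphere :: "nat \<Rightarrow> vertex set \<Rightarrow> nat \<Rightarrow> nat" where
  "max_sphere n B k = Max ((\<lambda>x. card {y \<in> B. hdist n x y = k}) ` hypercube n)"

text \<open>The radius is an integer because it is used at \<open>g n - 1\<close>, and the ball of radius \<open>-1\<close> is empty.\<close>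

definition max_ball :: "nat \<Rightarrow> vertex set \<Rightarrow> int \<Rightarrow> nat" where
  "max_ball n B r = Max ((\<lambda>x. card {y \<in> B. int (hdist n x y) \<le> r}) ` hypercube n)"

text \<open>Only meaningful when \<open>v\<close> is eventually positive.\<close>

definition much_less :: "(nat \<Rightarrow> real) \<Rightarrow> (nat \<Rightarrow> real) \<Rightarrow> bool"  (infix "\<lless>" 50) where
  "u \<lless> v \<longleftrightarrow> (\<lambda>n. u n / v n) \<longlonglongrightarrow> 0"


lemma finite_hypercube [simp]: "finite (hypercube n)"
  by (simp add: hypercube_def finite_PiE)

lemma hypercube_nonempty [simp]: "hypercube n \<noteq> {}"
  by (simp add: hypercube_def PiE_eq_empty_iff)

lemma card_hypercube: "card (hypercube n) = 2 ^ n"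
  by (simp add: hypercube_def card_PiE numeral_2_eq_2)

lemma card_neighbours:
  assumes x: "x \<in> hypercube n"
  shows "card {y \<in> hypercube n. hdist n x y = 1} = n"
proof -
  let ?f = "\<lambda>i. x(i := 1 - x i)"
  have bin: "x i = 0 \<or> x i = 1" if "i \<in> {1..n}" for i
    using x that by (auto simp: hypercube_def PiE_iff)
  have ext: "x i = undefined" if "i \<notin> {1..n}" for i
    using x that by (auto simp: hypercube_def PiE_iff extensional_def)
  have ne: "1 - x i \<noteq> x i" if "i \<in> {1..n}" for i
    using bin[OF that] by auto
  have "{y \<in> hypercube n. hdist n x y = 1} = ?f ` {1..n}"
  proof (intro equalityI subsetI)
    fix y assume "y \<in> {y \<in> hypercube n. hdist n x y = 1}"
    then have y: "y \<in> hypercube n" and "card {i \<in> {1..n}. x i \<noteq> y i} = 1"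
      by (auto simp: hdist_def)
    then obtain i where i: "{i \<in> {1..n}. x i \<noteq> y i} = {i}"
      by (meson card_1_singletonE)
    then have iI: "i \<in> {1..n}" and xy: "x i \<noteq> y i" by auto
    have "y j = ?f i j" for j
    proof (cases "j \<in> {1..n}")
      case True
      have "y j = 0 \<or> y j = 1" using y True by (auto simp: hypercube_def PiE_iff)
      moreover have "x j = y j" if "j \<noteq> i" using i True that by blast
      ultimately show ?thesis using bin[OF True] xy by (cases "j = i") auto
    next
      case False
      then show ?thesis using y ext[OF False] iI
        by (auto simp: hypercube_def PiE_iff extensional_def)
    qed
    then show "y \<in> ?f ` {1..n}" using iI by blast
  next
    fix y assume "y \<in> ?f ` {1..n}"
    then obtain i where i: "i \<in> {1..n}" "y = ?f i" by auto
    have "{j \<in> {1..n}. x j \<noteq> y j} = {i}" using i ne[OF i(1)] by auto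
    moreover have "y \<in> hypercube n"
      using x i bin[OF i(1)] by (auto simp: hypercube_def PiE_iff extensional_def)
    ultimately show "y \<in> {y \<in> hypercube n. hdist n x y = 1}" by (simp add: hdist_def)
  qed
  moreover have "inj_on ?f {1..n}"
    by (rule inj_onI) (metis fun_upd_apply ne)
  ultimately show ?thesis by (simp add: card_image)
qed

lemma pmf_srw_step:
  assumes "n \<ge> 1" "x \<in> hypercube n" "y \<in> hypercube n"
  shows "pmf (srw_step n x) y = (if hdist n x y = 1 then 1 / real n else 0)"
proof -
  have "{y \<in> hypercube n. hdist n x y = 1} \<noteq> {}"
    using card_neighbours[OF assms(2)] assms(1) by (metis card.empty not_one_le_zero)
  then show ?thesis
    unfolding srw_step_def using card_neighbours[OF assms(2)] assms
    by (subst pmf_of_set) (auto simp: indicator_def)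
qed

lemma Ionescu_Tulcea_srw: "Ionescu_Tulcea (srw_kernel n x) (\<lambda>_. count_space UNIV)"
proof (rule Ionescu_Tulcea.intro)
  fix i
  show "srw_kernel n x i \<in>
    measurable (PiM {0..<i} (\<lambda>_. count_space UNIV)) (subprob_algebra (count_space UNIV))"
  proof (cases i)
    case 0
    then show ?thesis by (auto simp: srw_kernel_def[abs_def] intro!: measurable_const measure_pmf_in_subprob_algebra)
  next
    case (Suc j)
    have "(\<lambda>\<omega>. measure_pmf (srw_step n (\<omega> j))) \<in>
      measurable (PiM {0..<i} (\<lambda>_. count_space UNIV)) (subprob_algebra (count_space UNIV))"
    proof (rule measurable_compose[where f = "\<lambda>\<omega>. \<omega> j" and N = "count_space UNIV"])
      show "(\<lambda>\<omega>. \<omega> j) \<in> measurable (PiM {0..<i} (\<lambda>_. count_space UNIV)) (count_space UNIV)"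
        by (rule measurable_component_singleton) (simp add: Suc)
      show "(\<lambda>v. measure_pmf (srw_step n v)) \<in>
        measurable (count_space UNIV) (subprob_algebra (count_space UNIV))"
        by (simp add: measure_pmf_in_subprob_algebra)
    qed
    then show ?thesis by (simp add: srw_kernel_def[abs_def] Suc)
  qed
next
  fix i \<omega>
  show "prob_space (srw_kernel n x i \<omega>)"
    unfolding srw_kernel_def by (rule prob_space_measure_pmf)
qed

lemma sets_srw_law : "sets (srw_law n x) = sets (PiM UNIV (\<lambda>_. count_space UNIV))"
proof -
  interpret Ionescu_Tulcea "srw_kernel n x" "\<lambda>_. count_space UNIV"
    by (rule Ionescu_Tulcea_srw)
  show ?thesis unfolding srw_law_def by (rule PF.sets_lim)
qed

lemma space_srw_law [simp]: "space (srw_law n x) = UNIV"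
  using sets_eq_imp_space_eq[OF sets_srw_law] by (simp add: space_PiM)

lemma emeasure_srw_cylinder:
  "emeasure (srw_law n x) {\<omega>. \<forall>i<k. \<omega> i = y i} =
     (\<Prod>i<k. emeasure (srw_kernel n x i y) {y i})"
proof -
  let ?M = "\<lambda>_::nat. count_space (UNIV :: vertex set)"
  interpret Ionescu_Tulcea "srw_kernel n x" ?M
    by (rule Ionescu_Tulcea_srw)
  let ?X = "\<lambda>k. PiE {0..<k} (\<lambda>i. {y i})"
  have X [measurable]: "?X k \<in> sets (PiM {0..<k} ?M)" for k
    by (rule sets_PiM_I_finite) auto
  have "emeasure (C 0 k (\<lambda>_. undefined)) (?X k) =
     (\<Prod>i<k. emeasure (srw_kernel n x i y) {y i})" for k
  proof (induction k)
    case 0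
    then show ?case using X[of 0] by (simp add: emeasure_return)
  next
    case (Suc k)
    have "emeasure (C 0 (Suc k) (\<lambda>_. undefined)) (?X (Suc k)) =
      (\<integral>\<^sup>+\<omega>. emeasure (eP k \<omega>) (?X (Suc k)) \<partial>C 0 k (\<lambda>_. undefined))"
      unfolding C.simps
      by (subst emeasure_bind[where N = "PiM {0..<Suc k} ?M"])
         (use measurable_eP[of k] X[of "Suc k"] in
           \<open>auto simp: space_C space_PiM measurable_cong_sets[OF sets_C]\<close>)
    also have "\<dots> = (\<integral>\<^sup>+\<omega>. emeasure (srw_kernel n x k y) {y k} * indicator (?X k) \<omega>
        \<partial>C 0 k (\<lambda>_. undefined))"
    proof (rule nn_integral_cong)
      fix \<omega> assume "\<omega> \<in> space (C 0 k (\<lambda>_. undefined))"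
      then have \<omega>: "\<omega> \<in> space (PiM {0..<k} ?M)" by (simp add: space_C space_PiM)
      then have e: "\<omega> \<in> extensional {0..<k}" by (simp add: space_PiM PiE_iff)
      have v: "(fun_upd \<omega> k -` ?X (Suc k)) = (if \<omega> \<in> ?X k then {y k} else {})"
        using e by (auto simp: PiE_iff extensional_def atLeast0LessThan lessThan_Suc)
      have "srw_kernel n x k \<omega> = srw_kernel n x k y" if "\<omega> \<in> ?X k"
        using that by (cases k) (auto simp: srw_kernel_def PiE_iff)
      then show "emeasure (eP k \<omega>) (?X (Suc k)) =
          emeasure (srw_kernel n x k y) {y k} * indicator (?X k) \<omega>"
        by (subst emeasure_eP[OF \<omega> X]) (simp add: v)
    qed
    also have "\<dots> = emeasure (srw_kernel n x k y) {y k} * emeasure (C 0 k (\<lambda>_. undefined)) (?X k)"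
      by (subst nn_integral_cmult_indicator) (auto simp: sets_C space_PiM)
    finally show ?case by (simp add: Suc.IH mult.commute)
  qed
  moreover have "{\<omega>. \<forall>i<k. \<omega> i = y i} = PF.emb UNIV {0..<k} (?X k)"
    by (auto simp: prod_emb_def space_PiM PiE_iff)
  moreover have "emeasure (srw_law n x) (PF.emb UNIV {0..<k} (?X k)) = emeasure (CI {0..<k}) (?X k)"
    unfolding srw_law_def by (rule lim) auto
  moreover have "emeasure (CI {0..<k}) (?X k) = emeasure (C 0 k (\<lambda>_. undefined)) (?X k)"
    by (subst emeasure_CI[of _ k]) (auto simp: prod_emb_id space_PiM PiE_iff)
  ultimately show ?thesis by (simp only:)
qed

lemma prob_space_srw_law: "prob_space (srw_law n x)"
  by standard (use emeasure_srw_cylinder[of n x 0] in simp)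

lemma measure_srw_cylinder:
  "measure (srw_law n x) {\<omega>. \<forall>i\<le>k. \<omega> i = y i} =
     (if y 0 = x then \<Prod>i<k. pmf (srw_step n (y i)) (y (Suc i)) else 0)"
proof -
  have "{\<omega>. \<forall>i\<le>k. \<omega> i = y i} = {\<omega>. \<forall>i<Suc k. \<omega> i = y i}" for k
    by (auto simp: less_Suc_eq_le)
  then have "emeasure (srw_law n x) {\<omega>. \<forall>i\<le>k. \<omega> i = y i} =
     ennreal (if y 0 = x then \<Prod>i<k. pmf (srw_step n (y i)) (y (Suc i)) else 0)"
    by (simp add: emeasure_srw_cylinder prod.lessThan_Suc_shift srw_kernel_def emeasure_pmf_single
          prod_ennreal del: prod.lessThan_Suc)
  then show ?thesis by (simp add: measure_def prod_nonneg)
qed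

lemma srw_start: "measure (srw_law n x) {\<omega>. \<omega> 0 = x} = 1"
  using measure_srw_cylinder[of n x 0 "\<lambda>_. x"] by simp

text \<open>Markov property: the conditional law of the next position given the past.\<close>

lemma srw_transition:
  "measure (srw_law n x) {\<omega>. (\<forall>i\<le>k. \<omega> i = y i) \<and> \<omega> (Suc k) = z} =
     measure (srw_law n x) {\<omega>. \<forall>i\<le>k. \<omega> i = y i} * pmf (srw_step n (y k)) z"
proof -
  let ?y = "y(Suc k := z)"
  have "{\<omega>. (\<forall>i\<le>k. \<omega> i = y i) \<and> \<omega> (Suc k) = z} = {\<omega>. \<forall>i\<le>Suc k. \<omega> i = ?y i}"
    by (auto simp: le_Suc_eq)
  then show ?thesis by (simp add: measure_srw_cylinder)
qed

lemma hitting_time_ge_iff: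
  "ereal t \<le> ereal_of_enat (hitting_time A \<omega>) \<longleftrightarrow> (\<forall>k. real k < t \<longrightarrow> \<omega> k \<notin> A)"
proof (cases "\<exists>k. \<omega> k \<in> A")
  case True
  define K where "K = (LEAST k. \<omega> k \<in> A)"
  have K: "\<omega> K \<in> A" "\<And>k. \<omega> k \<in> A \<Longrightarrow> K \<le> k"
    using True LeastI_ex[of "\<lambda>k. \<omega> k \<in> A"] Least_le[of "\<lambda>k. \<omega> k \<in> A"] by (auto simp: K_def)
  have "hitting_time A \<omega> = enat K"
    unfolding hitting_time_def using K by (intro antisym INF_greatest INF_lower) auto
  then show ?thesis using K by (auto simp: not_less) (meson not_less of_nat_le_iff order_trans)
next
  case False
  then have "{k. \<omega> k \<in> A} = {}" by auto
  then show ?thesis using False by (simp add: hitting_time_def top_enat_def)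
qed

lemma hitting_time_event:
  "{\<omega>. ereal t \<le> ereal_of_enat (hitting_time A \<omega>)} \<in> sets (srw_law n x)"
proof -
  let ?P = "PiM UNIV (\<lambda>_::nat. count_space (UNIV :: vertex set))"
  have "{\<omega> \<in> space ?P. \<omega> k \<notin> A} \<in> sets ?P" for k
  proof -
    have "(\<lambda>\<omega>. \<omega> k) \<in> measurable ?P (count_space UNIV)"
      by (rule measurable_component_singleton) simp
    then have "(\<lambda>\<omega>. \<omega> k) -` (- A) \<inter> space ?P \<in> sets ?P"
      by (rule measurable_sets) simp
    moreover have "(\<lambda>\<omega>. \<omega> k) -` (- A) \<inter> space ?P = {\<omega> \<in> space ?P. \<omega> k \<notin> A}"
      by blast
    ultimately show ?thesis by (simp only:)
  qed
  then have "{\<omega> \<in> space ?P. \<forall>k. real k < t \<longrightarrow> \<omega> k \<notin> A} \<in> sets ?P"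
    by (intro sets.sets_Collect_countable_All sets.sets_Collect_imp sets.sets_Collect_const)
  then show ?thesis by (simp add: hitting_time_ge_iff sets_srw_law space_PiM)
qed

end

theory Submission
  imports Defs
begin

text \<open>
  Two features of the simple random walk make the hitting time of a sparse set exponential: the walk
  forgets its position after about \<open>n ln n \<lless> m\<close> steps, and by the hypotheses on \<open>\<xi>\<^sub>n\<close> it is unlikely
  to find a point of \<open>B - {x}\<close> before that when it starts from \<open>x\<close>, whatever \<open>x\<close> is.

  Let \<open>A = B - {x}\<close> have density \<open>\<theta> = |A| / 2\<^sup>n\<close>, let \<open>f\<^sub>k(z)\<close> be the probability that the walk from
  \<open>z\<close> avoids \<open>A\<close> at all times before \<open>k\<close>, and let \<open>F\<^sub>k\<close> be its average over the hypercube. By stationarity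
  \<open>F\<^sub>k - F\<^sub>k\<^sub>+\<^sub>1\<close> is \<open>\<theta>\<close> times the average over \<open>y \<in> A\<close> of the probability that the walk from \<open>y\<close> avoids
  \<open>A\<close> at the times \<open>1, \<dots>, k\<close>. If this probability is \<open>F\<^sub>k\<close> up to an error \<open>\<eta>\<close>, uniformly in \<open>y\<close>, then
  \<open>F\<^sub>k\<close> differs from \<open>(1 - \<theta>)\<^sup>k\<close> by at most \<open>\<eta>\<close>, uniformly in \<open>k\<close> (\<open>geometric_recursion_error\<close>). If also
  \<open>f\<^sub>k(x)\<close> is close to \<open>F\<^sub>k\<close>, then the claim follows, because \<open>(1 - \<theta>)\<^sup>k\<close> tends to \<open>exp (- a)\<close> for
  \<open>\<theta> \<sim> 1 / m\<close> and \<open>k \<sim> a m\<close>.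

  The comparison of \<open>f\<^sub>k\<close> with \<open>F\<^sub>k\<close> uses the lazy operator \<open>Q\<close>, half of the identity plus half of the
  transition operator. Since \<open>f\<^sub>k\<close> decreases in \<open>k\<close>, laziness costs nothing, and it spares all parity
  considerations. One application of \<open>Q\<close> shrinks the influence of every coordinate by the factor
  \<open>1 - 1 / n\<close>, so that \<open>Q\<^sup>s f\<^sub>k\<close> is within \<open>n (1 - 1 / n)\<^sup>s\<close> of its mean \<open>F\<^sub>k\<close> (\<open>lazy_op_mixing\<close>). On the one
  hand \<open>f\<^sub>k\<^sub>+\<^sub>s \<le> Q\<^sup>s f\<^sub>k\<close>. On the other hand \<open>Q\<^sup>s f\<^sub>k\<close> exceeds \<open>f\<^sub>k\<close> by at most the potential of \<open>A\<close> plus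
  \<open>s \<theta> / 2\<close> (\<open>lazy_op_pow_survival_le\<close>).

  The potential of a point at distance \<open>k\<close> is \<open>\<xi>\<^sub>n(k)\<close> plus a correction of order \<open>2\<^sup>-\<^sup>n n ln n\<close>. The
  harmonic numbers in the correction make it an exact solution of the Poisson equation of the walk
  (\<open>potential_poisson\<close>), which is why \<open>\<xi>\<^sub>n\<close> measures the early visits. Summed over \<open>B\<close> the corrections
  contribute \<open>O(n ln n / m)\<close>, while the values of \<open>\<xi>\<^sub>n\<close> are controlled by the spheres of radius less than
  \<open>g(n)\<close> and, since \<open>\<xi>\<^sub>n\<close> is decreasing, by \<open>|B| \<xi>\<^sub>n(g(n))\<close> beyond them (\<open>set_potential_le\<close>).

  Finally, the hypotheses on the balls and on \<open>\<xi>\<^sub>n(g(n))\<close> together force \<open>|B| \<rightarrow> \<infinity>\<close>, so that removing the point \<open>x\<close> does not change the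
  density asymptotically.
\<close>

section \<open>Single coordinate flips and the walk as an operator\<close>

definition flip :: "nat \<Rightarrow> vertex \<Rightarrow> vertex" where
  "flip i x = x(i := 1 - x i)"

definition walk_op :: "nat \<Rightarrow> (vertex \<Rightarrow> real) \<Rightarrow> vertex \<Rightarrow> real" where
  "walk_op n f x = (\<Sum>i=1..n. f (flip i x)) / real n"

definition lazy_op :: "nat \<Rightarrow> (vertex \<Rightarrow> real) \<Rightarrow> vertex \<Rightarrow> real" where
  "lazy_op n f x = (f x + walk_op n f x) / 2"

definition cube_mean :: "nat \<Rightarrow> (vertex \<Rightarrow> real) \<Rightarrow> real" where
  "cube_mean n f = (\<Sum>x\<in>hypercube n. f x) / 2 ^ n"

lemma hypercube_coord: "x \<in> hypercube n \<Longrightarrow> i \<in> {1..n} \<Longrightarrow> x i = 0 \<or> x i = 1"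
  by (auto simp: hypercube_def PiE_iff)

lemma hypercube_outside: "x \<in> hypercube n \<Longrightarrow> i \<notin> {1..n} \<Longrightarrow> x i = undefined"
  by (auto simp: hypercube_def PiE_iff extensional_def)

lemma flip_hypercube [simp]: "x \<in> hypercube n \<Longrightarrow> i \<in> {1..n} \<Longrightarrow> flip i x \<in> hypercube n"
  using hypercube_coord[of x n i]
  by (auto simp: hypercube_def flip_def PiE_iff extensional_def)

lemma flip_flip: "x \<in> hypercube n \<Longrightarrow> i \<in> {1..n} \<Longrightarrow> flip i (flip i x) = x"
  using hypercube_coord[of x n i] by (auto simp: flip_def)

lemma flip_commute: "flip i (flip j x) = flip j (flip i x)"
  by (cases "i = j") (auto simp: flip_def)

lemma hdist_eq_0_iff:
  assumes "x \<in> hypercube n" "y \<in> hypercube n"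
  shows "hdist n x y = 0 \<longleftrightarrow> x = y"
proof
  assume "hdist n x y = 0"
  then have "{i \<in> {1..n}. x i \<noteq> y i} = {}" by (simp add: hdist_def)
  then have "x i = y i" for i
    using assms[THEN hypercube_outside, of i] by (cases "i \<in> {1..n}") auto
  then show "x = y" by blast
qed (simp add: hdist_def)

lemma hdist_self [simp]: "hdist n x x = 0"
  by (simp add: hdist_def)

lemma hdist_le: "hdist n x y \<le> n"
proof -
  have "hdist n x y \<le> card {1..n}" unfolding hdist_def by (rule card_mono) auto
  then show ?thesis by simp
qed

lemma hdist_flip_differ:
  assumes "x \<in> hypercube n" "y \<in> hypercube n" "i \<in> {1..n}" "x i \<noteq> y i"
  shows "Suc (hdist n (flip i x) y) = hdist n x y"
proof -
  have "flip i x i = y i"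
    using hypercube_coord[OF assms(1,3)] hypercube_coord[OF assms(2,3)] assms(4)
    by (auto simp: flip_def)
  then have "{j \<in> {1..n}. flip i x j \<noteq> y j} = {j \<in> {1..n}. x j \<noteq> y j} - {i}"
    by (auto simp: flip_def)
  moreover have "i \<in> {j \<in> {1..n}. x j \<noteq> y j}" using assms by auto
  ultimately show ?thesis unfolding hdist_def
    by (metis (no_types, lifting) card_Suc_Diff1 finite_Collect_conjI finite_atLeastAtMost
        finite_nat_set_iff_bounded_le mem_Collect_eq atLeastAtMost_iff)
qed

lemma hdist_flip_agree:
  assumes "x \<in> hypercube n" "i \<in> {1..n}" "x i = y i"
  shows "hdist n (flip i x) y = Suc (hdist n x y)"
proof -
  have "flip i x i \<noteq> y i"
    using hypercube_coord[OF assms(1,2)] assms(3) by (auto simp: flip_def)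
  then have "{j \<in> {1..n}. flip i x j \<noteq> y j} = insert i {j \<in> {1..n}. x j \<noteq> y j}"
    using assms by (auto simp: flip_def)
  moreover have "i \<notin> {j \<in> {1..n}. x j \<noteq> y j}" using assms by auto
  ultimately show ?thesis by (simp add: hdist_def)
qed

text \<open>On functions of the distance to a fixed vertex the walk acts as the Ehrenfest
  birth-and-death chain, since exactly \<open>hdist n x y\<close> of the flips reduce the distance.\<close>

lemma walk_op_hdist:
  assumes "x \<in> hypercube n" "y \<in> hypercube n"
  shows "walk_op n (\<lambda>z. \<phi> (hdist n z y)) x =
    (real (hdist n x y) * \<phi> (hdist n x y - 1)
      + real (n - hdist n x y) * \<phi> (Suc (hdist n x y))) / real n"
proof -
  let ?D = "{i \<in> {1..n}. x i \<noteq> y i}" and ?E = "{i \<in> {1..n}. x i = y i}"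
  have split: "{1..n} = ?D \<union> ?E" "?D \<inter> ?E = {}" by auto
  have "card {1..n} = card ?D + card ?E"
    by (subst split(1), rule card_Un_disjoint) auto
  then have E: "card ?E = n - hdist n x y" by (simp add: hdist_def)
  have "(\<Sum>i=1..n. \<phi> (hdist n (flip i x) y)) =
      (\<Sum>i\<in>?D. \<phi> (hdist n (flip i x) y)) + (\<Sum>i\<in>?E. \<phi> (hdist n (flip i x) y))"
    by (subst split(1), rule sum.union_disjoint) auto
  also have "(\<Sum>i\<in>?D. \<phi> (hdist n (flip i x) y)) = (\<Sum>i\<in>?D. \<phi> (hdist n x y - 1))"
    by (rule sum.cong) (auto simp flip: hdist_flip_differ[OF assms])
  also have "(\<Sum>i\<in>?E. \<phi> (hdist n (flip i x) y)) = (\<Sum>i\<in>?E. \<phi> (Suc (hdist n x y)))"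
    by (rule sum.cong) (auto simp: hdist_flip_agree[OF assms(1)])
  finally have "(\<Sum>i=1..n. \<phi> (hdist n (flip i x) y)) =
      real (card ?D) * \<phi> (hdist n x y - 1) + real (card ?E) * \<phi> (Suc (hdist n x y))"
    by (simp only: sum_constant)
  moreover have "card ?D = hdist n x y" by (simp add: hdist_def)
  ultimately show ?thesis unfolding walk_op_def by (simp only: E)
qed

lemma walk_op_mono:
  assumes "\<And>z. z \<in> hypercube n \<Longrightarrow> f z \<le> g z" "x \<in> hypercube n"
  shows "walk_op n f x \<le> walk_op n g x"
  unfolding walk_op_def using assms by (intro divide_right_mono sum_mono) auto

lemma walk_op_add: "walk_op n (\<lambda>z. f z + g z) x = walk_op n f x + walk_op n g x"
  by (simp add: walk_op_def sum.distrib add_divide_distrib)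

lemma walk_op_sum: "walk_op n (\<lambda>z. \<Sum>w\<in>A. f w z) x = (\<Sum>w\<in>A. walk_op n (f w) x)"
  unfolding walk_op_def by (subst sum.swap) (simp add: sum_divide_distrib)

lemma walk_op_const [simp]: "n \<ge> 1 \<Longrightarrow> walk_op n (\<lambda>z. c) x = c"
  by (simp add: walk_op_def)

lemma lazy_op_mono:
  assumes "\<And>z. z \<in> hypercube n \<Longrightarrow> f z \<le> g z" "x \<in> hypercube n"
  shows "lazy_op n f x \<le> lazy_op n g x"
  unfolding lazy_op_def using walk_op_mono[OF assms] assms by (simp add: add_mono)

lemma lazy_op_add_const: "n \<ge> 1 \<Longrightarrow> lazy_op n (\<lambda>z. f z + c) x = lazy_op n f x + c"
  by (simp add: lazy_op_def walk_op_add add_divide_distrib)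

lemma lazy_op_pow_mono:
  assumes "\<And>z. z \<in> hypercube n \<Longrightarrow> f z \<le> g z" "x \<in> hypercube n"
  shows "(lazy_op n ^^ s) f x \<le> (lazy_op n ^^ s) g x"
  using assms(2)
proof (induction s arbitrary: x)
  case (Suc s)
  then show ?case by (simp add: lazy_op_mono)
qed (simp add: assms(1))

lemma cube_mean_mono:
  assumes "\<And>z. z \<in> hypercube n \<Longrightarrow> f z \<le> g z"
  shows "cube_mean n f \<le> cube_mean n g"
  unfolding cube_mean_def using assms by (intro divide_right_mono sum_mono) auto

lemma cube_mean_const [simp]: "cube_mean n (\<lambda>z. c) = c"
  by (simp add: cube_mean_def card_hypercube)

lemma cube_mean_walk_op:
  assumes "n \<ge> 1"
  shows "cube_mean n (walk_op n f) = cube_mean n f"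
proof -
  have "(\<Sum>x\<in>hypercube n. f (flip i x)) = (\<Sum>x\<in>hypercube n. f x)" if "i \<in> {1..n}" for i
    using that by (intro sum.reindex_bij_witness[of _ "flip i" "flip i"]) (simp_all add: flip_flip)
  then have "(\<Sum>x\<in>hypercube n. \<Sum>i=1..n. f (flip i x)) = real n * (\<Sum>x\<in>hypercube n. f x)"
    by (subst sum.swap) simp
  then show ?thesis using assms
    by (simp add: cube_mean_def walk_op_def flip: sum_divide_distrib)
qed

lemma cube_mean_lazy_op:
  assumes "n \<ge> 1"
  shows "cube_mean n (lazy_op n f) = cube_mean n f"
proof -
  have "cube_mean n (lazy_op n f) = (cube_mean n f + cube_mean n (walk_op n f)) / 2"
    by (simp add: cube_mean_def lazy_op_def sum.distrib add_divide_distrib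
        flip: sum_divide_distrib)
  then show ?thesis by (simp add: cube_mean_walk_op[OF assms])
qed

lemma cube_mean_lazy_op_pow: "n \<ge> 1 \<Longrightarrow> cube_mean n ((lazy_op n ^^ s) f) = cube_mean n f"
  by (induction s) (simp_all add: cube_mean_lazy_op)

section \<open>Mixing of the lazy walk\<close>

text \<open>With probability \<open>1 / n\<close> the lazy step selects coordinate \<open>i\<close>, and then the outcome has the
  same law from \<open>x\<close> and from \<open>flip i x\<close>, since it stays put or flips \<open>i\<close> with equal probability. Otherwise the step
  commutes with \<open>flip i\<close> and preserves the bound on the influence.\<close>

lemma lazy_op_influence:
  assumes n: "n \<ge> 1" and x: "x \<in> hypercube n" and i: "i \<in> {1..n}"
    and c: "\<And>z. z \<in> hypercube n \<Longrightarrow> \<bar>f z - f (flip i z)\<bar> \<le> c"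
  shows "\<bar>lazy_op n f x - lazy_op n f (flip i x)\<bar> \<le> (1 - 1 / real n) * c"
proof -
  let ?d = "\<lambda>z. f z - f (flip i z)"
  have I: "{1..n} = insert i ({1..n} - {i})" using i by auto
  have "(\<Sum>j=1..n. f (flip j x) - f (flip j (flip i x))) =
      - ?d x + (\<Sum>j\<in>{1..n} - {i}. ?d (flip j x))"
    by (subst I, subst sum.insert) (auto simp: flip_flip[OF x i] flip_commute)
  moreover have "lazy_op n f x - lazy_op n f (flip i x) =
      (?d x + (\<Sum>j=1..n. f (flip j x) - f (flip j (flip i x))) / real n) / 2"
    by (simp add: lazy_op_def walk_op_def sum_subtractf diff_divide_distrib add_divide_distrib)
  ultimately have "lazy_op n f x - lazy_op n f (flip i x) =
      (?d x + (- ?d x + (\<Sum>j\<in>{1..n} - {i}. ?d (flip j x))) / real n) / 2"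
    by (simp only:)
  also have "\<dots> = ((real n - 1) * ?d x + (\<Sum>j\<in>{1..n} - {i}. ?d (flip j x))) / (2 * real n)"
    using n by (simp add: field_simps)
  also have "\<bar>\<dots>\<bar> \<le> ((real n - 1) * c + (real n - 1) * c) / (2 * real n)"
  proof -
    have "\<bar>\<Sum>j\<in>{1..n} - {i}. ?d (flip j x)\<bar> \<le> (\<Sum>j\<in>{1..n} - {i}. c)"
      by (rule order_trans[OF sum_abs sum_mono]) (use c x in auto)
    also have "\<dots> = (real n - 1) * c" using i n by (simp add: of_nat_diff)
    finally have 1: "\<bar>\<Sum>j\<in>{1..n} - {i}. ?d (flip j x)\<bar> \<le> (real n - 1) * c" .
    have "\<bar>(real n - 1) * ?d x\<bar> \<le> (real n - 1) * c"
      using n c[OF x] by (simp add: abs_mult mult_left_mono)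
    with 1 have "\<bar>(real n - 1) * ?d x + (\<Sum>j\<in>{1..n} - {i}. ?d (flip j x))\<bar>
        \<le> (real n - 1) * c + (real n - 1) * c" by linarith
    then show ?thesis
      unfolding abs_divide abs_of_nonneg[OF mult_nonneg_nonneg[OF zero_le_numeral of_nat_0_le_iff]]
      by (rule divide_right_mono) simp
  qed
  also have "\<dots> = (1 - 1 / real n) * c" using n by (simp add: field_simps)
  finally show ?thesis .
qed

lemma lazy_op_pow_influence:
  assumes "n \<ge> 1" and "\<And>z. z \<in> hypercube n \<Longrightarrow> \<bar>f z - f (flip i z)\<bar> \<le> 1"
    and "i \<in> {1..n}" and "x \<in> hypercube n"
  shows "\<bar>(lazy_op n ^^ s) f x - (lazy_op n ^^ s) f (flip i x)\<bar> \<le> (1 - 1 / real n) ^ s"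
  using assms(4)
proof (induction s arbitrary: x)
  case (Suc s)
  then show ?case using lazy_op_influence[OF assms(1) Suc.prems assms(3)] by simp
qed (use assms in auto)

text \<open>Two vertices are joined by a path of at most \<open>n\<close> flips.\<close>

lemma oscillation_le:
  assumes "\<And>z i. z \<in> hypercube n \<Longrightarrow> i \<in> {1..n} \<Longrightarrow> \<bar>f z - f (flip i z)\<bar> \<le> c"
    and "x \<in> hypercube n" "y \<in> hypercube n"
  shows "\<bar>f x - f y\<bar> \<le> real n * c"
proof (cases "n = 0")
  case True
  then show ?thesis using assms hdist_le[of n x y] hdist_eq_0_iff[of x n y] by simp
next
  case False
  then have c: "c \<ge> 0" using assms(1)[OF assms(2), of 1] by force
  have "\<bar>f x - f y\<bar> \<le> real (hdist n x y) * c"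
    using assms(2)
  proof (induction "hdist n x y" arbitrary: x)
    case 0
    then show ?case using hdist_eq_0_iff[of x n y] assms(3) by simp
  next
    case (Suc d)
    then have "{i \<in> {1..n}. x i \<noteq> y i} \<noteq> {}" unfolding hdist_def by (metis card.empty nat.simps(3))
    then obtain i where i: "i \<in> {1..n}" "x i \<noteq> y i" by auto
    have d: "hdist n (flip i x) y = d"
      using hdist_flip_differ[OF Suc.prems assms(3) i] Suc.hyps(2) by simp
    have "\<bar>f x - f y\<bar> \<le> \<bar>f x - f (flip i x)\<bar> + \<bar>f (flip i x) - f y\<bar>" by simp
    also have "\<dots> \<le> c + real d * c"
      using assms(1)[OF Suc.prems i(1)] Suc.hyps(1)[of "flip i x"] d Suc.prems i(1)
      by (intro add_mono) auto
    finally show ?case using Suc.hyps(2) by (simp add: algebra_simps flip: Suc.hyps(2))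
  qed
  also have "\<dots> \<le> real n * c" using hdist_le c by (simp add: mult_right_mono)
  finally show ?thesis .
qed

text \<open>By invariance of the mean, a function with small oscillation is close to its original mean.\<close>

lemma lazy_op_mixing:
  assumes n: "n \<ge> 1" and f: "\<And>z. z \<in> hypercube n \<Longrightarrow> 0 \<le> f z \<and> f z \<le> 1" and x: "x \<in> hypercube n"
  shows "\<bar>(lazy_op n ^^ s) f x - cube_mean n f\<bar> \<le> real n * (1 - 1 / real n) ^ s"
proof -
  let ?g = "(lazy_op n ^^ s) f" and ?c = "real n * (1 - 1 / real n) ^ s"
  have inf: "\<bar>f z - f (flip i z)\<bar> \<le> 1" if "z \<in> hypercube n" "i \<in> {1..n}" for z i
    using f[OF that(1)] f[OF flip_hypercube[OF that]] by linarith
  have "\<bar>?g z - ?g (flip i z)\<bar> \<le> (1 - 1 / real n) ^ s"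
    if "z \<in> hypercube n" "i \<in> {1..n}" for z i
    by (rule lazy_op_pow_influence[OF n _ that(2,1)]) (rule inf[OF _ that(2)])
  then have osc: "\<bar>?g y - ?g x\<bar> \<le> ?c" if "y \<in> hypercube n" for y
    using oscillation_le[OF _ that x] by blast
  have "cube_mean n ?g \<le> cube_mean n (\<lambda>_. ?g x + ?c)" "cube_mean n (\<lambda>_. ?g x - ?c) \<le> cube_mean n ?g"
    using osc by (intro cube_mean_mono; fastforce simp: abs_le_iff)+
  then show ?thesis by (simp add: cube_mean_lazy_op_pow[OF n] abs_le_iff)
qed

section \<open>The potential of the walk\<close>

text \<open>By \<open>potential_poisson\<close> below, this function of the distance to a vertex \<open>y\<close> is the Green's
  function of the walk, up to an additive constant: the generator maps it to the point mass at \<open>y\<close>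
  minus the uniform distribution. The harmonic correction to \<open>\<xi>\<^sub>n\<close> makes the Poisson equation exact;
  the constant \<open>harm n\<close> keeps the potential nonnegative.\<close>

definition potential :: "nat \<Rightarrow> nat \<Rightarrow> real" where
  "potential n k = xi n k + real n / 2 ^ Suc n * (harm n - harm k)"

definition binomial_tail :: "nat \<Rightarrow> nat \<Rightarrow> real" where
  "binomial_tail n k = (\<Sum>i=k..n. real (n choose i))"

lemma binomial_tail_Suc: "k \<le> n \<Longrightarrow> binomial_tail n k = real (n choose k) + binomial_tail n (Suc k)"
  by (simp add: binomial_tail_def sum.atLeast_Suc_atMost)

lemma binomial_tail_0: "binomial_tail n 0 = 2 ^ n"
proof -
  have "binomial_tail n 0 = real (\<Sum>i\<le>n. n choose i)"
    by (simp add: binomial_tail_def atMost_atLeast0)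
  then show ?thesis by (simp add: choose_row_sum del: of_nat_sum)
qed

lemma binomial_tail_shift:
  assumes "k \<le> n"
  shows "binomial_tail n (Suc k) = (\<Sum>j=1..n-k. real (n choose (k + j)))"
  unfolding binomial_tail_def
  by (rule sum.reindex_bij_witness[of _ "\<lambda>j. k + j" "\<lambda>i. i - k"]) (use assms in auto)

text \<open>The sum occurring in \<open>\<xi>\<^sub>n(k)\<close>. Its recursion in \<open>k\<close> comes from splitting
  \<open>(n - k) / j = 1 + (n - k - j) / j\<close> and absorbing \<open>n - k - j\<close> into the binomial coefficient.\<close>

definition xi_sum :: "nat \<Rightarrow> nat \<Rightarrow> real" where
  "xi_sum n k = (\<Sum>j = 1..n - k. real (n choose (k + j)) / real j)"

lemma xi_eq: "xi n k = real n / 2 ^ Suc n * xi_sum n k / real (n choose k)"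
  by (simp add: xi_def xi_sum_def)

lemma choose_absorb_real: "real (n - k) * real (n choose k) = real (Suc k) * real (n choose Suc k)"
  using binomial_absorption[of k n] binomial_absorb_comp[of n k]
  by (simp only: flip: of_nat_mult)

lemma xi_sum_rec:
  assumes k: "k < n"
  shows "real (n - k) * xi_sum n k =
    real (Suc k) * xi_sum n (Suc k) + 2 * binomial_tail n (Suc k) - real (n choose Suc k)"
proof -
  let ?c = "\<lambda>j. real (n choose (Suc k + j))"
  have 1: "real (n - k) * (real (n choose (k + j)) / real j) =
      real (n choose (k + j)) + (real (Suc k) * (?c j / real j) + ?c j)"
    if "j \<in> {1..n-k}" for j
  proof -
    have "real (n - (k + j)) * real (n choose (k + j)) = real (Suc (k + j)) * ?c j"
      by (subst choose_absorb_real) simp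
    moreover have "real (n - (k + j)) = real (n - k) - real j" using that k by auto
    ultimately have "(real (n - k) - real j) * real (n choose (k + j)) =
        (real (Suc k) + real j) * ?c j" by simp
    moreover have "real j > 0" using that by simp
    ultimately show ?thesis by (simp add: divide_simps) (simp add: algebra_simps)
  qed
  have top: "n - k = Suc (n - Suc k)" using k by simp
  \<comment> \<open>The summand \<open>j = n - k\<close> contributes nothing, because \<open>n choose Suc n = 0\<close>.\<close>
  have drop: "(\<Sum>j=1..n-k. h j) = (\<Sum>j=1..n-Suc k. h j)" if "h (n - k) = 0" for h :: "nat \<Rightarrow> real"
    using that unfolding top by simp
  have last: "?c (n - k) = 0" using k by (intro of_nat_eq_0_iff[THEN iffD2] binomial_eq_0) simp
  have "real (n - k) * xi_sum n k =
      (\<Sum>j=1..n-k. real (n choose (k + j)) + (real (Suc k) * (?c j / real j) + ?c j))"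
    unfolding xi_sum_def sum_distrib_left by (rule sum.cong[OF refl 1])
  also have "\<dots> = binomial_tail n (Suc k)
      + (real (Suc k) * (\<Sum>j=1..n-k. ?c j / real j) + (\<Sum>j=1..n-k. ?c j))"
    using k by (simp only: sum.distrib sum_distrib_left binomial_tail_shift less_imp_le)
  also have "(\<Sum>j=1..n-k. ?c j / real j) = xi_sum n (Suc k)"
    unfolding xi_sum_def by (rule drop) (simp only: last div_0)
  also have "(\<Sum>j=1..n-k. ?c j) = binomial_tail n (Suc (Suc k))"
    using k by (subst drop) (simp_all only: last binomial_tail_shift Suc_leI)
  also have "\<dots> = binomial_tail n (Suc k) - real (n choose Suc k)"
    using binomial_tail_Suc[of "Suc k" n] k by simp
  finally show ?thesis by simp
qed

text \<open>The flux of the Green's function out of the ball of radius \<open>k\<close>: it carries the uniform mass of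
  all vertices at larger distance.\<close>

lemma potential_diff:
  assumes k: "k < n"
  shows "real (n - k) * (potential n k - potential n (Suc k)) =
    real n * binomial_tail n (Suc k) / (2 ^ n * real (n choose k))"
proof -
  let ?c = "real n / 2 ^ Suc n" and ?C = "real (n choose k)" and ?C' = "real (n choose Suc k)"
  have pos: "?C > 0" "?C' > 0" using k by (simp_all add: zero_less_binomial)
  have absorb: "real (n - k) * ?C = real (Suc k) * ?C'" by (rule choose_absorb_real)
  have "real (n - k) * (xi_sum n k / ?C - xi_sum n (Suc k) / ?C' + 1 / real (Suc k)) * ?C =
      real (n - k) * xi_sum n k - (real (n - k) * ?C) * xi_sum n (Suc k) / ?C'
        + (real (n - k) * ?C) / real (Suc k)"
  proof -
    have "A * (X / ?C - Y / D + 1 / Z) * ?C = A * X - (A * ?C) * Y / D + (A * ?C) / Z"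
      for A X Y D Z :: real
      using pos by (simp add: algebra_simps)
    then show ?thesis .
  qed
  also have "\<dots> = real (n - k) * xi_sum n k - real (Suc k) * xi_sum n (Suc k) + ?C'"
    unfolding absorb using pos by simp
  also have "\<dots> = 2 * binomial_tail n (Suc k)" by (simp add: xi_sum_rec[OF k])
  finally have "real (n - k) * (xi_sum n k / ?C - xi_sum n (Suc k) / ?C' + 1 / real (Suc k)) * ?C =
      2 * binomial_tail n (Suc k)" .
  then have main: "real (n - k) * (xi_sum n k / ?C - xi_sum n (Suc k) / ?C' + 1 / real (Suc k)) =
      2 * binomial_tail n (Suc k) / ?C"
    by (rule eq_divide_imp[OF less_imp_neq[OF pos(1), symmetric]])
  have "potential n k - potential n (Suc k) =
      ?c * (xi_sum n k / ?C - xi_sum n (Suc k) / ?C' + 1 / real (Suc k))"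
    by (simp only: potential_def xi_eq harm_Suc inverse_eq_divide ring_distribs times_divide_eq_right)
  then have "real (n - k) * (potential n k - potential n (Suc k)) =
      ?c * (real (n - k) * (xi_sum n k / ?C - xi_sum n (Suc k) / ?C' + 1 / real (Suc k)))"
    by (simp only: mult.left_commute)
  also have "\<dots> = real n * binomial_tail n (Suc k) / (2 ^ n * ?C)" unfolding main by simp
  finally show ?thesis .
qed

text \<open>The Poisson equation, written for the Ehrenfest chain of the distance. The fluxes through two
  consecutive spheres differ by the uniform mass in between.\<close>

lemma potential_poisson:
  assumes n: "n \<ge> 1" and k: "k \<le> n"
  shows "(real k * potential n (k - 1) + real (n - k) * potential n (Suc k)) / real n =
    potential n k - (if k = 0 then 1 else 0) + 1 / 2 ^ n"
proof -
  let ?C = "real (n choose k)"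
  have C: "?C > 0" using k by (simp add: zero_less_binomial)
  have up: "real (n - k) * (potential n k - potential n (Suc k)) =
      real n * binomial_tail n (Suc k) / (2 ^ n * ?C)"
    using potential_diff[of k n] k by (cases "k = n") (auto simp: binomial_tail_def)
  have down: "real k * (potential n (k - 1) - potential n k) =
      real n * (if k = 0 then 0 else binomial_tail n k) / (2 ^ n * ?C)"
  proof (cases k)
    case (Suc l)
    have l: "real (n - l) > 0" "real (n choose l) > 0" using k Suc by (simp_all add: zero_less_binomial)
    have "real (n - l) * real (n choose l) = real k * ?C" unfolding Suc by (rule choose_absorb_real)
    moreover have "potential n l - potential n k =
        real n * binomial_tail n k / (2 ^ n * (real (n - l) * real (n choose l)))"
      using potential_diff[of l n] k Suc l by (simp add: field_simps)
    ultimately show ?thesis using C Suc by simp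
  qed simp
  have "real k * potential n (k - 1) + real (n - k) * potential n (Suc k) =
      real n * potential n k + real k * (potential n (k - 1) - potential n k)
        - real (n - k) * (potential n k - potential n (Suc k))"
    using k by (simp add: of_nat_diff algebra_simps)
  also have "\<dots> = real n * (potential n k
      + ((if k = 0 then 0 else binomial_tail n k) - binomial_tail n (Suc k)) / (2 ^ n * ?C))"
    unfolding up down by (simp add: algebra_simps diff_divide_distrib)
  also have "(if k = 0 then 0 else binomial_tail n k) - binomial_tail n (Suc k) =
      ?C - (if k = 0 then 2 ^ n else 0)"
    using binomial_tail_Suc[OF k] binomial_tail_0[of n] by (cases "k = 0") auto
  finally have "(real k * potential n (k - 1) + real (n - k) * potential n (Suc k)) / real n =
      potential n k + (?C - (if k = 0 then 2 ^ n else 0)) / (2 ^ n * ?C)"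
    using n by simp
  then show ?thesis using C by (cases "k = 0") (simp_all add: diff_divide_distrib)
qed

lemma xi_nonneg: "xi n k \<ge> 0"
  unfolding xi_def by (intro mult_nonneg_nonneg sum_nonneg) auto

lemma potential_nonneg: "k \<le> n \<Longrightarrow> potential n k \<ge> 0"
  using xi_nonneg[of n k] harm_mono[of k n, where 'a = real] by (simp add: potential_def)

lemma potential_le: "potential n k \<le> xi n k + real n / 2 ^ Suc n * harm n"
proof -
  have "real n / 2 ^ Suc n * (harm n - harm k) \<le> real n / 2 ^ Suc n * harm n"
    by (rule mult_left_mono) (simp_all add: harm_nonneg)
  then show ?thesis by (simp only: potential_def add_left_mono)
qed

lemma xi_Suc_le:
  assumes k: "k < n"
  shows "xi n (Suc k) \<le> xi n k"
proof -
  let ?C = "real (n choose k)" and ?C' = "real (n choose Suc k)"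
  have C: "?C > 0" using k by (simp add: zero_less_binomial)
  have "binomial_tail n (Suc k) \<ge> ?C'"
    using binomial_tail_Suc[of "Suc k" n] k by (simp add: binomial_tail_def sum_nonneg)
  then have "real n * ?C' / (2 ^ n * ?C) \<le> real (n - k) * (potential n k - potential n (Suc k))"
    unfolding potential_diff[OF k] using C by (intro divide_right_mono mult_left_mono) auto
  also have "real n * ?C' / (2 ^ n * ?C) = real (n - k) * (real n / 2 ^ n / real (Suc k))"
  proof -
    have "?C' = real (n - k) * ?C / real (Suc k)"
      using choose_absorb_real[of n k] by simp
    then show ?thesis using C by (simp add: mult_ac)
  qed
  finally have "real n / 2 ^ n / real (Suc k) \<le> potential n k - potential n (Suc k)"
    by (rule mult_left_le_imp_le) (use k in simp)
  moreover have "potential n k - potential n (Suc k) =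
      xi n k - xi n (Suc k) + real n / 2 ^ Suc n * (1 / real (Suc k))"
    by (simp only: potential_def harm_Suc inverse_eq_divide ring_distribs)
  moreover have "real n / 2 ^ n / real (Suc k) = 2 * (real n / 2 ^ Suc n * (1 / real (Suc k)))"
    by simp
  moreover have "real n / 2 ^ Suc n * (1 / real (Suc k)) \<ge> 0" by simp
  ultimately show ?thesis by linarith
qed

lemma xi_antimono:
  assumes "k \<le> l" "l \<le> n"
  shows "xi n l \<le> xi n k"
  using assms
proof (induction l rule: dec_induct)
  case (step l)
  then show ?case using xi_Suc_le[of l n] by simp
qed simp

text \<open>An early return to the starting point passes through a neighbour, so that its cost is measured by
  \<open>\<xi>\<^sub>n(1)\<close>. The factor \<open>1 / n\<close> comes from absorbing \<open>1 / j\<close> into the binomial coefficients.\<close>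

lemma xi_1_le: "n \<ge> 1 \<Longrightarrow> xi n 1 \<le> 3 / real n"
proof -
  assume n: "n \<ge> 1"
  have 1: "real (n choose Suc j) / real j \<le> 3 / real (Suc n) * real (Suc n choose Suc (Suc j))"
    if "j \<in> {1..n-1}" for j
  proof -
    have "real (Suc (Suc j)) * real (Suc n choose Suc (Suc j)) = real (Suc n) * real (n choose Suc j)"
      using Suc_times_binomial[of "Suc j" n] by (simp only: flip: of_nat_mult)
    then have "3 / real (Suc n) * real (Suc n choose Suc (Suc j)) =
        3 * real (n choose Suc j) / real (Suc (Suc j))" by (simp add: field_simps)
    moreover have "1 / real j \<le> 3 / real (Suc (Suc j))" using that by (simp add: field_simps)
    then have "1 / real j * real (n choose Suc j) \<le> 3 / real (Suc (Suc j)) * real (n choose Suc j)"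
      by (rule mult_right_mono) simp
    ultimately show ?thesis by simp
  qed
  have "xi_sum n 1 \<le> (\<Sum>j=1..n-1. 3 / real (Suc n) * real (Suc n choose Suc (Suc j)))"
    unfolding xi_sum_def using 1 by (intro sum_mono) simp
  also have "\<dots> = 3 / real (Suc n) * (\<Sum>i=3..Suc n. real (Suc n choose i))"
    unfolding sum_distrib_left
    by (rule sum.reindex_bij_witness[of _ "\<lambda>i. i - 2" "\<lambda>j. Suc (Suc j)"]) (auto simp: numeral_2_eq_2)
  also have "\<dots> \<le> 3 / real (Suc n) * binomial_tail (Suc n) 0"
    unfolding binomial_tail_def by (intro mult_left_mono sum_mono2) auto
  also have "\<dots> = 2 ^ Suc n * (3 / real (Suc n))" by (simp add: binomial_tail_0)
  finally have "xi_sum n 1 / 2 ^ Suc n \<le> 3 / real (Suc n)" by (simp add: field_simps)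
  also have "\<dots> \<le> 3 / real n" using n by (intro divide_left_mono) auto
  finally show ?thesis using n by (simp add: xi_eq)
qed

lemma xi_0_ge:
  assumes n: "n \<ge> 1"
  shows "xi n 0 \<ge> 1 / 4"
proof -
  have "binomial_tail n 1 / real n \<le> xi_sum n 0"
    unfolding xi_sum_def binomial_tail_def sum_divide_distrib using n
    by simp (intro sum_mono divide_left_mono, auto)
  moreover have "binomial_tail n 1 = 2 ^ n - 1"
    using binomial_tail_Suc[of 0 n] by (simp add: binomial_tail_0)
  ultimately have "2 ^ n - 1 \<le> real n * xi_sum n 0" using n by (simp add: field_simps)
  moreover have "(2::real) ^ n \<ge> 2 ^ 1" using n by (intro power_increasing) auto
  ultimately have "2 ^ Suc n / 4 \<le> real n * xi_sum n 0" by simp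
  then show ?thesis by (simp add: xi_eq field_simps)
qed

section \<open>Survival probabilities\<close>

text \<open>The probability that the walk from \<open>x\<close> avoids \<open>A\<close> at the times \<open>0, \<dots>, k - 1\<close>; see
  \<open>measure_srw_avoid\<close>.\<close>

primrec survival :: "nat \<Rightarrow> vertex set \<Rightarrow> nat \<Rightarrow> vertex \<Rightarrow> real" where
  "survival n A 0 x = 1"
| "survival n A (Suc k) x = (if x \<in> A then 0 else walk_op n (survival n A k) x)"

lemma survival_bounds: "n \<ge> 1 \<Longrightarrow> 0 \<le> survival n A k x \<and> survival n A k x \<le> 1"
proof (induction k arbitrary: x)
  case (Suc k)
  have "(\<Sum>i=1..n. survival n A k (flip i x)) \<le> (\<Sum>i=1..n. 1)"
    using Suc by (intro sum_mono) auto
  then show ?case using Suc by (auto simp: walk_op_def intro!: sum_nonneg divide_nonneg_nonneg)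
qed simp

lemma survival_Suc_le:
  assumes "n \<ge> 1" "x \<in> hypercube n"
  shows "survival n A (Suc k) x \<le> survival n A k x"
  using assms(2)
proof (induction k arbitrary: x)
  case 0
  then show ?case using survival_bounds[OF assms(1), of A "Suc 0" x] by simp
next
  case (Suc k)
  then show ?case by (auto intro: walk_op_mono simp del: survival.simps(2)
      simp add: survival.simps(2)[of n A k] survival.simps(2)[of n A "Suc k"])
qed

lemma survival_Suc_le_lazy_op:
  assumes "n \<ge> 1" "x \<in> hypercube n"
  shows "survival n A (Suc k) x \<le> lazy_op n (survival n A k) x"
proof -
  have "survival n A (Suc k) x \<le> walk_op n (survival n A k) x"
    using survival_bounds[OF assms(1), of A k] by (auto simp: walk_op_def intro!: sum_nonneg divide_nonneg_nonneg)
  with survival_Suc_le[OF assms, of A k] show ?thesis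
    unfolding lazy_op_def by (simp del: survival.simps)
qed

lemma survival_add_le_lazy_op_pow:
  assumes "n \<ge> 1" "x \<in> hypercube n"
  shows "survival n A (k + s) x \<le> (lazy_op n ^^ s) (survival n A k) x"
  using assms(2)
proof (induction s arbitrary: x)
  case (Suc s)
  have "survival n A (k + Suc s) x \<le> lazy_op n (survival n A (k + s)) x"
    using survival_Suc_le_lazy_op[OF assms(1) Suc.prems, of A "k + s"] by simp
  also have "\<dots> \<le> lazy_op n ((lazy_op n ^^ s) (survival n A k)) x"
    by (rule lazy_op_mono) (use Suc in auto)
  finally show ?case by simp
qed simp

subsection \<open>A supersolution from the potential\<close>

definition set_potential :: "nat \<Rightarrow> vertex set \<Rightarrow> vertex \<Rightarrow> real" where
  "set_potential n A x = (\<Sum>w\<in>A. potential n (hdist n x w))"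

definition cube_density :: "nat \<Rightarrow> vertex set \<Rightarrow> real" where
  "cube_density n A = real (card A) / 2 ^ n"

lemma set_potential_nonneg: "set_potential n A x \<ge> 0"
  unfolding set_potential_def by (intro sum_nonneg potential_nonneg hdist_le)

lemma cube_density_bounds:
  assumes "A \<subseteq> hypercube n"
  shows "0 \<le> cube_density n A" "cube_density n A \<le> 1"
proof -
  have "card A \<le> card (hypercube n)" using assms by (intro card_mono) auto
  then have "real (card A) \<le> 2 ^ n" by (simp add: card_hypercube)
  then show "cube_density n A \<le> 1" by (simp add: cube_density_def)
qed (simp add: cube_density_def)

lemma walk_op_set_potential:
  assumes n: "n \<ge> 1" and A: "A \<subseteq> hypercube n" and x: "x \<in> hypercube n"
  shows "walk_op n (set_potential n A) x = set_potential n A x - indicator A x + cube_density n A"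
proof -
  have fin: "finite A" using A finite_hypercube finite_subset by blast
  have "walk_op n (\<lambda>z. potential n (hdist n z w)) x =
      potential n (hdist n x w) - (if x = w then 1 else 0) + 1 / 2 ^ n" if "w \<in> A" for w
  proof -
    have w: "w \<in> hypercube n" using that A by blast
    then show ?thesis
      using walk_op_hdist[OF x w, of "potential n"] potential_poisson[OF n hdist_le, of x w]
      by (simp only: hdist_eq_0_iff[OF x w])
  qed
  then have "walk_op n (set_potential n A) x =
      (\<Sum>w\<in>A. potential n (hdist n x w) - (if x = w then 1 else 0) + 1 / 2 ^ n)"
    unfolding set_potential_def by (simp add: walk_op_sum)
  then show ?thesis using fin
    by (simp add: set_potential_def cube_density_def sum.distrib sum_subtractf indicator_def sum.delta)
qed

text \<open>A lazy step can increase the expected survival probability only from a vertex of \<open>A\<close>, and then by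
  at most one half. The potential decreases there by the same amount, so that the sum of the two is
  a supersolution up to a drift of half the density of \<open>A\<close> per step.\<close>

lemma lazy_op_pow_survival_le:
  assumes n: "n \<ge> 1" and A: "A \<subseteq> hypercube n" and x: "x \<in> hypercube n"
  shows "(lazy_op n ^^ s) (survival n A k) x \<le>
    survival n A k x + set_potential n A x + real s * (cube_density n A / 2)"
proof -
  let ?u = "\<lambda>z. survival n A k z + set_potential n A z" and ?c = "cube_density n A / 2"
  have step: "lazy_op n ?u z \<le> ?u z + ?c" if z: "z \<in> hypercube n" for z
  proof -
    have "walk_op n (survival n A k) z \<le> survival n A k z + indicator A z"
    proof (cases "z \<in> A")
      case True
      have "walk_op n (survival n A k) z \<le> walk_op n (\<lambda>_. 1) z"
        by (rule walk_op_mono) (use survival_bounds[OF n] z in auto)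
      then show ?thesis using True survival_bounds[OF n, of A k z] n by simp
    next
      case False
      then show ?thesis using survival_Suc_le[OF n z, of A k] by simp
    qed
    then show ?thesis
      unfolding lazy_op_def walk_op_add walk_op_set_potential[OF n A z] by simp
  qed
  have "(lazy_op n ^^ s) ?u x \<le> ?u x + real s * ?c"
    using x
  proof (induction s arbitrary: x)
    case (Suc s)
    have "(lazy_op n ^^ Suc s) ?u x \<le> lazy_op n (\<lambda>z. ?u z + real s * ?c) x"
      using Suc by (simp add: lazy_op_mono)
    also have "\<dots> = lazy_op n ?u x + real s * ?c" by (rule lazy_op_add_const[OF n])
    also have "\<dots> \<le> ?u x + ?c + real s * ?c" using step[OF Suc.prems] by simp
    finally show ?case by (simp add: algebra_simps add_divide_distrib)
  qed simp
  moreover have "(lazy_op n ^^ s) (survival n A k) x \<le> (lazy_op n ^^ s) ?u x"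
    by (rule lazy_op_pow_mono[OF _ x]) (simp add: set_potential_nonneg)
  ultimately show ?thesis by simp
qed

subsection \<open>Comparison with a geometric law\<close>

definition mean_survival :: "nat \<Rightarrow> vertex set \<Rightarrow> nat \<Rightarrow> real" where
  "mean_survival n A k = cube_mean n (survival n A k)"

lemma mean_survival_0 [simp]: "mean_survival n A 0 = 1"
  by (simp add: mean_survival_def cube_mean_def card_hypercube)

text \<open>By stationarity, survival up to time \<open>k\<close> after a first step has the same probability as
  before that step.\<close>

lemma mean_survival_diff:
  assumes n: "n \<ge> 1" and A: "A \<subseteq> hypercube n"
  shows "mean_survival n A k - mean_survival n A (Suc k) =
    (\<Sum>y\<in>A. walk_op n (survival n A k) y) / 2 ^ n"
proof -
  have "mean_survival n A k = cube_mean n (walk_op n (survival n A k))"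
    by (simp add: mean_survival_def cube_mean_walk_op[OF n])
  then have "mean_survival n A k - mean_survival n A (Suc k) =
      (\<Sum>y\<in>hypercube n. if y \<in> A then walk_op n (survival n A k) y else 0) / 2 ^ n"
    unfolding mean_survival_def cube_mean_def
    by (auto simp flip: diff_divide_distrib sum_subtractf intro!: sum.cong)
  also have "(\<Sum>y\<in>hypercube n. if y \<in> A then walk_op n (survival n A k) y else 0) =
      (\<Sum>y\<in>A. walk_op n (survival n A k) y)"
    using A by (simp add: sum.inter_restrict[symmetric] Int_absorb1)
  finally show ?thesis .
qed

lemma mean_survival_drop:
  assumes n: "n \<ge> 1" and A: "A \<subseteq> hypercube n"
  shows "mean_survival n A k - mean_survival n A (Suc k) \<le> cube_density n A"
proof -
  have "(\<Sum>y\<in>A. walk_op n (survival n A k) y) \<le> (\<Sum>y\<in>A. walk_op n (\<lambda>_. 1) y)"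
    using A survival_bounds[OF n] by (intro sum_mono walk_op_mono) auto
  then show ?thesis using n by (simp add: mean_survival_diff[OF n A] cube_density_def divide_right_mono)
qed

lemma mean_survival_lower:
  assumes n: "n \<ge> 1" and A: "A \<subseteq> hypercube n"
  shows "mean_survival n A k \<le> mean_survival n A (k + s) + real s * cube_density n A"
proof (induction s)
  case (Suc s)
  then show ?case using mean_survival_drop[OF n A, of "k + s"] by (simp add: algebra_simps)
qed simp

lemma survival_mixing:
  assumes n: "n \<ge> 1" and x: "x \<in> hypercube n"
  shows "\<bar>(lazy_op n ^^ s) (survival n A k) x - mean_survival n A k\<bar> \<le> real n * (1 - 1 / real n) ^ s"
  unfolding mean_survival_def by (rule lazy_op_mixing[OF n _ x]) (rule survival_bounds[OF n])

text \<open>Ignoring \<open>A\<close> during the first \<open>s\<close> steps lets the walk mix, and a mixed walk meets \<open>A\<close> within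
  \<open>s\<close> steps with probability at most \<open>s\<close> times the density.\<close>

lemma survival_upper:
  assumes n: "n \<ge> 1" and A: "A \<subseteq> hypercube n" and x: "x \<in> hypercube n"
  shows "survival n A k x \<le>
    mean_survival n A k + real n * (1 - 1 / real n) ^ s + real s * cube_density n A"
proof (cases "s \<le> k")
  case True
  have "survival n A k x \<le> (lazy_op n ^^ s) (survival n A (k - s)) x"
    using survival_add_le_lazy_op_pow[OF n x, of A "k - s" s] True by simp
  also have "\<dots> \<le> mean_survival n A (k - s) + real n * (1 - 1 / real n) ^ s"
    using survival_mixing[OF n x, of s A "k - s"] by (simp add: abs_le_iff)
  also have "mean_survival n A (k - s) \<le> mean_survival n A k + real s * cube_density n A"
    using mean_survival_lower[OF n A, of "k - s" s] True by simp
  finally show ?thesis by simp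
next
  case False
  have "survival n A k x \<le> 1" using survival_bounds[OF n] by blast
  also have "1 = mean_survival n A 0" by simp
  also have "\<dots> \<le> mean_survival n A k + real k * cube_density n A"
    using mean_survival_lower[OF n A, of 0 k] by simp
  also have "real k * cube_density n A \<le> real s * cube_density n A"
    using False cube_density_bounds[OF A] by (intro mult_right_mono) auto
  finally have "survival n A k x \<le> mean_survival n A k + real s * cube_density n A" by simp
  moreover have "real n * (1 - 1 / real n) ^ s \<ge> 0" using n by simp
  ultimately show ?thesis by linarith
qed

lemma survival_lower:
  assumes n: "n \<ge> 1" and A: "A \<subseteq> hypercube n" and x: "x \<in> hypercube n"
  shows "mean_survival n A k - real n * (1 - 1 / real n) ^ s - real s * cube_density n A
    \<le> survival n A k x + set_potential n A x"
proof -
  have "mean_survival n A k - real n * (1 - 1 / real n) ^ s \<le> (lazy_op n ^^ s) (survival n A k) x"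
    using survival_mixing[OF n x, of s A k] by (simp add: abs_le_iff)
  also have "\<dots> \<le> survival n A k x + set_potential n A x + real s * (cube_density n A / 2)"
    by (rule lazy_op_pow_survival_le[OF n A x])
  also have "real s * (cube_density n A / 2) \<le> real s * cube_density n A"
    using cube_density_bounds[OF A] by (intro mult_left_mono) auto
  finally show ?thesis by simp
qed

text \<open>The inherited error shrinks by the factor \<open>1 - \<theta>\<close> while each step adds only \<open>\<theta> * \<eta>\<close>, so that
  the bound \<open>\<eta>\<close> reproduces itself.\<close>

lemma geometric_recursion_error:
  fixes F :: "nat \<Rightarrow> real"
  assumes "F 0 = 1" "\<And>k. \<bar>F (Suc k) - (1 - \<theta>) * F k\<bar> \<le> \<theta> * \<eta>" "0 \<le> \<theta>" "\<theta> \<le> 1" "0 \<le> \<eta>"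
  shows "\<bar>F k - (1 - \<theta>) ^ k\<bar> \<le> \<eta>"
proof (induction k)
  case (Suc k)
  have "\<bar>F (Suc k) - (1 - \<theta>) ^ Suc k\<bar>
      \<le> \<bar>F (Suc k) - (1 - \<theta>) * F k\<bar> + (1 - \<theta>) * \<bar>F k - (1 - \<theta>) ^ k\<bar>"
  proof -
    have "F (Suc k) - (1 - \<theta>) ^ Suc k =
        (F (Suc k) - (1 - \<theta>) * F k) + (1 - \<theta>) * (F k - (1 - \<theta>) ^ k)"
      by (simp add: algebra_simps)
    moreover have "\<bar>(1 - \<theta>) * (F k - (1 - \<theta>) ^ k)\<bar> = (1 - \<theta>) * \<bar>F k - (1 - \<theta>) ^ k\<bar>"
      using assms(4) by (simp add: abs_mult)
    ultimately show ?thesis by (metis abs_triangle_ineq)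
  qed
  also have "\<dots> \<le> \<theta> * \<eta> + (1 - \<theta>) * \<eta>"
    using assms(4) by (intro add_mono mult_left_mono assms(2) Suc) auto
  finally show ?case by (simp add: algebra_simps)
qed (use assms in simp)

text \<open>The parameter \<open>\<rho>\<close> controls the early visits to other points of \<open>A\<close>, for the walk started from \<open>x\<close> or from a point of \<open>A\<close>; early returns to the starting point itself are
  accounted for by \<open>potential n 1\<close>. The parameter \<open>s\<close> is a mixing time, to be chosen small compared
  with the inverse of the density.\<close>

lemma survival_geometric:
  assumes n: "n \<ge> 1" and A: "A \<subseteq> hypercube n" and x: "x \<in> hypercube n" "x \<notin> A"
    and \<rho>: "\<And>y. y \<in> insert x A \<Longrightarrow> set_potential n (A - {y}) y \<le> \<rho>"
  shows "\<bar>survival n A k x - (1 - cube_density n A) ^ k\<bar> \<le>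
    2 * (real n * (1 - 1 / real n) ^ s + real (Suc s) * cube_density n A + \<rho> + potential n 1)"
proof -
  let ?\<delta> = "real n * (1 - 1 / real n) ^ s" and ?\<theta> = "cube_density n A"
  define \<eta> where "\<eta> = ?\<delta> + real (Suc s) * ?\<theta> + \<rho> + potential n 1"
  have fin: "finite A" using A finite_hypercube finite_subset by blast
  have pos: "?\<delta> \<ge> 0" "?\<theta> \<ge> 0" "real s * ?\<theta> \<ge> 0" "potential n 1 \<ge> 0" "\<rho> \<ge> 0"
    using n cube_density_bounds[OF A] potential_nonneg[of 1 n]
      order_trans[OF set_potential_nonneg \<rho>[OF insertI1]] by auto
  have \<eta>: "?\<delta> + real s * ?\<theta> + ?\<theta> + \<rho> + potential n 1 = \<eta>" by (simp add: \<eta>_def algebra_simps)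
  have upper: "survival n A k z \<le> mean_survival n A k + \<eta>" if "z \<in> hypercube n" for z k
    using survival_upper[OF n A that, of k s] pos \<eta> by linarith
  have lower: "mean_survival n A k - ?\<delta> - real s * ?\<theta> - set_potential n A z \<le> survival n A k z"
    if "z \<in> hypercube n" for z k
    using survival_lower[OF n A that, of k s] by linarith
  \<comment> \<open>From a point \<open>y\<close> of \<open>A\<close> the first step is taken unconditionally. It lowers the potential of \<open>y\<close>
    itself from \<open>potential n 0\<close> to \<open>potential n 1\<close>.\<close>
  have escape: "\<bar>walk_op n (survival n A k) y - mean_survival n A k\<bar> \<le> \<eta>" if y: "y \<in> A" for y k
  proof -
    have yc: "y \<in> hypercube n" using y A by blast
    have "walk_op n (survival n A k) y \<le> walk_op n (\<lambda>_. mean_survival n A k + \<eta>) y"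
      by (rule walk_op_mono[OF upper yc])
    moreover have "walk_op n (set_potential n A) y \<le> \<rho> + potential n 1 + ?\<theta>"
    proof -
      have "set_potential n A y = set_potential n (A - {y}) y + potential n 0"
        using y fin by (simp add: set_potential_def sum.remove)
      moreover have "potential n 0 - 1 \<le> potential n 1"
        using potential_poisson[OF n, of 0] n by simp
      moreover have "set_potential n (A - {y}) y \<le> \<rho>" using \<rho> y by blast
      ultimately show ?thesis using walk_op_set_potential[OF n A yc] y by simp
    qed
    moreover have "walk_op n (\<lambda>_. mean_survival n A k - ?\<delta> - real s * ?\<theta>) y
        \<le> walk_op n (\<lambda>z. survival n A k z + set_potential n A z) y"
      using lower yc by (intro walk_op_mono) (auto simp: algebra_simps)
    ultimately show ?thesis using n \<eta> by (simp add: walk_op_add abs_le_iff)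
  qed
  have "\<bar>mean_survival n A (Suc k) - (1 - ?\<theta>) * mean_survival n A k\<bar> \<le> ?\<theta> * \<eta>" for k
  proof -
    have "(\<Sum>y\<in>A. walk_op n (survival n A k) y - mean_survival n A k) / 2 ^ n =
        (mean_survival n A k - mean_survival n A (Suc k)) - ?\<theta> * mean_survival n A k"
      unfolding mean_survival_diff[OF n A]
      by (simp add: cube_density_def sum_subtractf diff_divide_distrib)
    then have "mean_survival n A (Suc k) - (1 - ?\<theta>) * mean_survival n A k =
        - ((\<Sum>y\<in>A. walk_op n (survival n A k) y - mean_survival n A k) / 2 ^ n)"
      by (simp only:) (simp add: algebra_simps)
    also have "\<bar>\<dots>\<bar> \<le> (\<Sum>y\<in>A. \<eta>) / 2 ^ n"
    proof -
      have "\<bar>\<Sum>y\<in>A. walk_op n (survival n A k) y - mean_survival n A k\<bar> \<le> (\<Sum>y\<in>A. \<eta>)"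
        by (rule order_trans[OF sum_abs sum_mono]) (rule escape)
      then show ?thesis by (simp add: abs_divide divide_right_mono)
    qed
    also have "\<dots> = ?\<theta> * \<eta>" by (simp add: cube_density_def)
    finally show ?thesis .
  qed
  then have "\<bar>mean_survival n A k - (1 - ?\<theta>) ^ k\<bar> \<le> \<eta>"
    using cube_density_bounds[OF A] pos \<eta>
    by (intro geometric_recursion_error) auto
  moreover have "\<bar>survival n A k x - mean_survival n A k\<bar> \<le> \<eta>"
  proof -
    have "set_potential n A x \<le> \<rho>" using \<rho>[of x] x(2) by simp
    then have "mean_survival n A k - \<eta> \<le> survival n A k x"
      using lower[OF x(1), of k] pos \<eta> by linarith
    with upper[OF x(1), of k] show ?thesis by (simp add: abs_le_iff)
  qed
  ultimately have "\<bar>survival n A k x - (1 - ?\<theta>) ^ k\<bar> \<le> 2 * \<eta>" by linarith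
  then show ?thesis by (simp only: \<eta>_def)
qed

section \<open>Survival probabilities of the simple random walk\<close>

lemma neighbours_eq_flips:
  assumes x: "x \<in> hypercube n"
  shows "{y \<in> hypercube n. hdist n x y = 1} = (\<lambda>i. flip i x) ` {1..n}"
    and "inj_on (\<lambda>i. flip i x) {1..n}"
proof -
  have ne: "1 - x i \<noteq> x i" if "i \<in> {1..n}" for i
    using hypercube_coord[OF x that] by auto
  show inj: "inj_on (\<lambda>i. flip i x) {1..n}"
  proof (rule inj_onI, rule ccontr)
    fix i j assume i: "i \<in> {1..n}" and eq: "flip i x = flip j x" and "i \<noteq> j"
    have "flip i x i = flip j x i" by (simp only: eq)
    then show False using \<open>i \<noteq> j\<close> ne[OF i] by (simp add: flip_def)
  qed
  have "hdist n x (flip i x) = 1" if "i \<in> {1..n}" for i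
  proof -
    have "{j \<in> {1..n}. x j \<noteq> flip i x j} = {i}" using that ne[OF that] by (auto simp: flip_def)
    then show ?thesis by (simp add: hdist_def)
  qed
  then have "(\<lambda>i. flip i x) ` {1..n} \<subseteq> {y \<in> hypercube n. hdist n x y = 1}"
    using x by auto
  moreover have "card ((\<lambda>i. flip i x) ` {1..n}) = card {y \<in> hypercube n. hdist n x y = 1}"
    using card_image[OF inj] card_neighbours[OF x] by simp
  ultimately show "{y \<in> hypercube n. hdist n x y = 1} = (\<lambda>i. flip i x) ` {1..n}"
    by (intro card_subset_eq[symmetric, OF finite_subset[OF _ finite_hypercube]]) auto
qed

lemma sum_pmf_srw_step:
  assumes n: "n \<ge> 1" and x: "x \<in> hypercube n"
  shows "(\<Sum>z\<in>hypercube n. pmf (srw_step n x) z * f z) = walk_op n f x"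
proof -
  have "(\<Sum>z\<in>hypercube n. pmf (srw_step n x) z * f z) =
      (\<Sum>z\<in>hypercube n. if hdist n x z = 1 then f z / real n else 0)"
    by (rule sum.cong) (simp_all add: pmf_srw_step[OF n x])
  also have "\<dots> = (\<Sum>z\<in>{z \<in> hypercube n. hdist n x z = 1}. f z / real n)"
    by (rule sum.inter_filter[symmetric]) simp
  also have "\<dots> = walk_op n f x"
    unfolding neighbours_eq_flips(1)[OF x] sum.reindex[OF neighbours_eq_flips(2)[OF x]] walk_op_def
    by (simp add: sum_divide_distrib)
  finally show ?thesis .
qed

lemma measurable_srw_coordinate:
  "(\<lambda>\<omega>. \<omega> k) \<in> measurable (srw_law n x) (count_space UNIV)"
  using measurable_component_singleton[of k UNIV "\<lambda>_. count_space (UNIV :: vertex set)"]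
  by (simp add: measurable_cong_sets[OF sets_srw_law refl])

lemma srw_confined_event:
  "{\<omega>. (\<forall>i\<le>k. \<omega> i \<in> D i) \<and> \<omega> l \<in> E} \<in> sets (srw_law n x)"
proof -
  have coord: "{\<omega>. \<omega> i \<in> S} \<in> sets (srw_law n x)" for i S
    using measurable_sets[OF measurable_srw_coordinate, of S i n x] by (simp add: vimage_def)
  have "{\<omega>. (\<forall>i\<le>k. \<omega> i \<in> D i) \<and> \<omega> l \<in> E} = (\<Inter>i\<in>{..k}. {\<omega>. \<omega> i \<in> D i}) \<inter> {\<omega>. \<omega> l \<in> E}"
    by auto
  also have "\<dots> \<in> sets (srw_law n x)"
    by (intro sets.Int sets.finite_INT coord) auto
  finally show ?thesis .
qed

text \<open>For finite \<open>D\<close> the event involves only finitely many pasts, in contrast to the event of avoiding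
  a set.\<close>

definition confined_prob :: "nat \<Rightarrow> vertex \<Rightarrow> vertex set \<Rightarrow> nat \<Rightarrow> vertex \<Rightarrow> real" where
  "confined_prob n x D k z = measure (srw_law n x) {\<omega>. (\<forall>i\<le>k. \<omega> i \<in> D) \<and> \<omega> k = z}"

text \<open>Both sides are decomposed over the finitely many possible pasts; on each of them the Markov
  property applies.\<close>

lemma confined_prob_Suc:
  assumes D: "finite D" and z: "z \<in> D"
  shows "confined_prob n x D (Suc k) z =
    (\<Sum>w\<in>D. confined_prob n x D k w * pmf (srw_step n w) z)"
proof -
  interpret prob_space "srw_law n x" by (rule prob_space_srw_law)
  define P where "P = PiE {..k} (\<lambda>_. D)"
  define C where "C y = {\<omega>. \<forall>i\<le>k. \<omega> i = y i}" for y :: "nat \<Rightarrow> vertex"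
  define E where "E y = {\<omega>. (\<forall>i\<le>k. \<omega> i = y i) \<and> \<omega> (Suc k) = z}" for y :: "nat \<Rightarrow> vertex"
  have finP: "finite P" using D by (simp add: P_def finite_PiE)
  have P_D: "y i \<in> D" if "y \<in> P" "i \<le> k" for y i
    using that by (simp add: P_def PiE_iff)
  have restrict_P: "restrict \<omega> {..k} \<in> P \<longleftrightarrow> (\<forall>i\<le>k. \<omega> i \<in> D)" for \<omega> :: "nat \<Rightarrow> vertex"
    by (auto simp: P_def restrict_PiE_iff)
  have in_C: "\<omega> \<in> C y \<longleftrightarrow> restrict \<omega> {..k} = y" if "y \<in> P" for \<omega> y
  proof
    assume "\<omega> \<in> C y"
    show "restrict \<omega> {..k} = y"
    proof
      fix i
      show "restrict \<omega> {..k} i = y i"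
        using \<open>\<omega> \<in> C y\<close> that by (cases "i \<le> k") (auto simp: C_def P_def PiE_iff extensional_def)
    qed
  next
    assume "restrict \<omega> {..k} = y"
    then have "y i = \<omega> i" if "i \<le> k" for i using that by auto
    then show "\<omega> \<in> C y" by (simp add: C_def)
  qed
  have E_eq: "E y = C y \<inter> {\<omega>. \<omega> (Suc k) = z}" for y
    by (auto simp: E_def C_def)
  have events: "C y \<in> events" "E y \<in> events" for y
    using srw_confined_event[of k "\<lambda>i. {y i}" 0 UNIV] srw_confined_event[of k "\<lambda>i. {y i}" "Suc k" "{z}"]
    by (simp_all add: C_def E_def)
  have past: "confined_prob n x D k w = (\<Sum>y\<in>{y \<in> P. y k = w}. prob (C y))" for w
  proof -
    have "{\<omega>. (\<forall>i\<le>k. \<omega> i \<in> D) \<and> \<omega> k = w} = (\<Union>y\<in>{y \<in> P. y k = w}. C y)"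
    proof (intro set_eqI)
      fix \<omega> :: "nat \<Rightarrow> vertex"
      have "\<omega> \<in> (\<Union>y\<in>{y \<in> P. y k = w}. C y) \<longleftrightarrow> (\<exists>y. y \<in> P \<and> y k = w \<and> restrict \<omega> {..k} = y)"
        using in_C by blast
      also have "\<dots> \<longleftrightarrow> \<omega> \<in> {\<omega>. (\<forall>i\<le>k. \<omega> i \<in> D) \<and> \<omega> k = w}"
        using restrict_P[of \<omega>] by auto
      finally show "\<omega> \<in> {\<omega>. (\<forall>i\<le>k. \<omega> i \<in> D) \<and> \<omega> k = w} \<longleftrightarrow> \<omega> \<in> (\<Union>y\<in>{y \<in> P. y k = w}. C y)"
        by (rule sym)
    qed
    moreover have "prob (\<Union>y\<in>{y \<in> P. y k = w}. C y) = (\<Sum>y\<in>{y \<in> P. y k = w}. prob (C y))"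
      using finP events in_C by (intro finite_measure_finite_Union) (auto simp: disjoint_family_on_def)
    ultimately show ?thesis by (simp only: confined_prob_def)
  qed
  have "{\<omega>. (\<forall>i\<le>Suc k. \<omega> i \<in> D) \<and> \<omega> (Suc k) = z} = (\<Union>y\<in>P. E y)"
  proof (intro set_eqI)
    fix \<omega> :: "nat \<Rightarrow> vertex"
    have "\<omega> \<in> (\<Union>y\<in>P. E y) \<longleftrightarrow> restrict \<omega> {..k} \<in> P \<and> \<omega> (Suc k) = z"
      unfolding E_eq by (auto simp: in_C)
    then show "\<omega> \<in> {\<omega>. (\<forall>i\<le>Suc k. \<omega> i \<in> D) \<and> \<omega> (Suc k) = z} \<longleftrightarrow> \<omega> \<in> (\<Union>y\<in>P. E y)"
      using z by (simp only: restrict_P mem_Collect_eq) (auto simp: le_Suc_eq)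
  qed
  moreover have "prob (\<Union>y\<in>P. E y) = (\<Sum>y\<in>P. prob (E y))"
    using finP events in_C by (intro finite_measure_finite_Union) (auto simp: disjoint_family_on_def E_eq)
  ultimately have "confined_prob n x D (Suc k) z = (\<Sum>y\<in>P. prob (E y))"
    by (simp only: confined_prob_def)
  also have "\<dots> = (\<Sum>y\<in>P. prob (C y) * pmf (srw_step n (y k)) z)"
    by (simp only: srw_transition C_def E_def)
  also have "\<dots> = (\<Sum>w\<in>D. \<Sum>y\<in>{y \<in> P. y k = w}. prob (C y) * pmf (srw_step n (y k)) z)"
    by (rule sum.group[symmetric]) (use finP D P_D in auto)
  also have "\<dots> = (\<Sum>w\<in>D. confined_prob n x D k w * pmf (srw_step n w) z)"
    by (simp add: past sum_distrib_right)
  finally show ?thesis .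
qed

text \<open>The forward evolution of the walk killed on \<open>A\<close> is dual to the backward recursion that defines
  \<open>survival\<close>: each step in the induction moves one unit of time from the past to the future.\<close>

lemma confined_prob_survival:
  assumes n: "n \<ge> 1" and x: "x \<in> hypercube n"
  shows "(\<Sum>z\<in>hypercube n - A. confined_prob n x (hypercube n - A) k z * walk_op n (survival n A j) z) =
    survival n A (Suc k + j) x"
proof (induction k arbitrary: j)
  case 0
  let ?D = "hypercube n - A"
  interpret prob_space "srw_law n x" by (rule prob_space_srw_law)
  have "confined_prob n x ?D 0 z = (if z = x then 1 else 0)" if "z \<in> ?D" for z
  proof -
    have "{\<omega> :: nat \<Rightarrow> vertex. (\<forall>i\<le>0. \<omega> i \<in> ?D) \<and> \<omega> 0 = z} = {\<omega>. \<forall>i\<le>0. \<omega> i = z}" using that by auto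
    then show ?thesis using measure_srw_cylinder[of n x 0 "\<lambda>_. z"] by (simp add: confined_prob_def)
  qed
  then have "(\<Sum>z\<in>?D. confined_prob n x ?D 0 z * walk_op n (survival n A j) z) =
      (\<Sum>z\<in>?D. if z = x then walk_op n (survival n A j) z else 0)"
    by (intro sum.cong) auto
  then show ?case using x by (simp add: sum.delta)
next
  case (Suc k)
  let ?D = "hypercube n - A" and ?f = "walk_op n (survival n A j)"
  have step: "(\<Sum>z\<in>?D. pmf (srw_step n w) z * ?f z) = walk_op n (survival n A (Suc j)) w"
    if w: "w \<in> ?D" for w
  proof -
    have "(\<Sum>z\<in>?D. pmf (srw_step n w) z * ?f z) =
        (\<Sum>z\<in>hypercube n. pmf (srw_step n w) z * survival n A (Suc j) z)"
      by (intro sum.mono_neutral_cong_left) auto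
    also have "\<dots> = walk_op n (survival n A (Suc j)) w"
      using w by (intro sum_pmf_srw_step[OF n]) simp
    finally show ?thesis .
  qed
  have "(\<Sum>z\<in>?D. confined_prob n x ?D (Suc k) z * ?f z) =
      (\<Sum>z\<in>?D. \<Sum>w\<in>?D. confined_prob n x ?D k w * (pmf (srw_step n w) z * ?f z))"
    by (intro sum.cong refl) (simp add: confined_prob_Suc sum_distrib_right mult.assoc)
  also have "\<dots> = (\<Sum>w\<in>?D. confined_prob n x ?D k w * (\<Sum>z\<in>?D. pmf (srw_step n w) z * ?f z))"
    by (subst sum.swap) (simp add: sum_distrib_left)
  also have "\<dots> = (\<Sum>w\<in>?D. confined_prob n x ?D k w * walk_op n (survival n A (Suc j)) w)"
    by (intro sum.cong refl) (simp only: step)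
  also have "\<dots> = survival n A (Suc k + Suc j) x" by (rule Suc)
  finally show ?case by simp
qed

lemma measure_srw_confined:
  assumes n: "n \<ge> 1" and x: "x \<in> hypercube n"
  shows "measure (srw_law n x) {\<omega>. \<forall>i\<le>k. \<omega> i \<in> hypercube n - A} = survival n A (Suc k) x"
proof -
  let ?D = "hypercube n - A"
  interpret prob_space "srw_law n x" by (rule prob_space_srw_law)
  have "{\<omega>. \<forall>i\<le>k. \<omega> i \<in> ?D} = (\<Union>z\<in>?D. {\<omega>. (\<forall>i\<le>k. \<omega> i \<in> ?D) \<and> \<omega> k = z})" by auto
  then have "prob {\<omega>. \<forall>i\<le>k. \<omega> i \<in> ?D} = (\<Sum>z\<in>?D. confined_prob n x ?D k z)"
  proof (simp only:, subst finite_measure_finite_Union)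
    show "(\<lambda>z. {\<omega>. (\<forall>i\<le>k. \<omega> i \<in> ?D) \<and> \<omega> k = z}) ` ?D \<subseteq> events"
      using srw_confined_event[of k "\<lambda>_. ?D" k "{z}" for z] by auto
  qed (auto simp: disjoint_family_on_def confined_prob_def)
  also have "\<dots> = (\<Sum>z\<in>?D. confined_prob n x ?D k z * walk_op n (survival n A 0) z)"
    using n by (simp add: walk_op_def)
  also have "\<dots> = survival n A (Suc k) x" by (simp only: confined_prob_survival[OF n x] add_0_right)
  finally show ?thesis .
qed

text \<open>The trajectories that leave the hypercube form a null set.\<close>

lemma measure_srw_avoid:
  assumes n: "n \<ge> 1" and x: "x \<in> hypercube n"
  shows "measure (srw_law n x) {\<omega>. \<forall>i<k. \<omega> i \<notin> A} = survival n A k x"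
proof (cases k)
  case 0
  interpret prob_space "srw_law n x" by (rule prob_space_srw_law)
  show ?thesis using 0 prob_space by simp
next
  case (Suc l)
  interpret prob_space "srw_law n x" by (rule prob_space_srw_law)
  have events: "{\<omega>. \<forall>i\<le>l. \<omega> i \<in> D} \<in> events" for D
    using srw_confined_event[of l "\<lambda>_. D" 0 UNIV] by simp
  have one: "survival n {} k x = 1" for k
    using n by (induction k arbitrary: x) (simp_all add: walk_op_def)
  have "AE \<omega> in srw_law n x. \<omega> \<in> {\<omega>. \<forall>i\<le>l. \<omega> i \<in> hypercube n}"
    using measure_srw_confined[OF n x, of l "{}"]
    by (subst AE_in_set_eq_1) (simp_all only: events one Diff_empty)
  then have "prob {\<omega>. \<forall>i\<le>l. \<omega> i \<in> - A} = prob {\<omega>. \<forall>i\<le>l. \<omega> i \<in> hypercube n - A}"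
    by (intro finite_measure_eq_AE events) auto
  then show ?thesis
    using measure_srw_confined[OF n x, of l A] Suc by (simp add: less_Suc_eq_le del: survival.simps)
qed

lemma measure_hitting_time_ge:
  assumes n: "n \<ge> 1" and x: "x \<in> hypercube n"
  shows "measure (srw_law n x) {\<omega>. ereal_of_enat (hitting_time A \<omega>) \<ge> ereal t} =
    survival n A (nat \<lceil>t\<rceil>) x"
proof -
  have "real k < t \<longleftrightarrow> k < nat \<lceil>t\<rceil>" for k
    by linarith
  then have "{\<omega>. ereal_of_enat (hitting_time A \<omega>) \<ge> ereal t} = {\<omega>. \<forall>k<nat \<lceil>t\<rceil>. \<omega> k \<notin> A}"
    by (simp add: hitting_time_ge_iff)
  then show ?thesis by (simp only: measure_srw_avoid[OF n x])
qed

section \<open>Early visits\<close>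

lemma card_sphere_le:
  assumes "y \<in> hypercube n"
  shows "card {w \<in> B. hdist n y w = k} \<le> max_sphere n B k"
  unfolding max_sphere_def using assms by (intro Max_ge) auto

text \<open>A point at distance less than \<open>r\<close> is charged to its sphere; all others have, by monotonicity,
  at most the potential of a point at distance \<open>r\<close>.\<close>

lemma set_potential_le:
  assumes B: "B \<subseteq> hypercube n" and y: "y \<in> hypercube n" and r: "r \<le> n"
  shows "set_potential n (B - {y}) y \<le>
    (\<Sum>k\<in>{1..<r}. real (max_sphere n B k) * xi n k) + real (card B) * xi n r
      + real (card B) * (real n / 2 ^ Suc n * harm n)"
proof -
  let ?d = "\<lambda>w. hdist n y w" and ?c = "real n / 2 ^ Suc n * harm n"
  let ?N = "{w \<in> B - {y}. ?d w < r}" and ?F = "{w \<in> B - {y}. \<not> ?d w < r}"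
  have fin: "finite B" using B finite_hypercube finite_subset by blast
  have d_pos: "?d w \<ge> 1" if "w \<in> B - {y}" for w
    using that B y hdist_eq_0_iff[of y n w] by (cases "?d w") auto
  have "set_potential n (B - {y}) y \<le> (\<Sum>w\<in>B - {y}. xi n (?d w) + ?c)"
    unfolding set_potential_def by (intro sum_mono potential_le)
  also have "\<dots> = (\<Sum>w\<in>B - {y}. xi n (?d w)) + real (card (B - {y})) * ?c"
    by (simp only: sum.distrib sum_constant)
  also have "(\<Sum>w\<in>B - {y}. xi n (?d w)) = (\<Sum>w\<in>?N. xi n (?d w)) + (\<Sum>w\<in>?F. xi n (?d w))"
    using fin by (subst sum.union_disjoint[symmetric]) (auto intro!: sum.cong)
  also have "(\<Sum>w\<in>?N. xi n (?d w)) = (\<Sum>k\<in>{1..<r}. \<Sum>w\<in>{w \<in> ?N. ?d w = k}. xi n (?d w))"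
    using fin d_pos by (intro sum.group[symmetric]) auto
  also have "\<dots> \<le> (\<Sum>k\<in>{1..<r}. real (max_sphere n B k) * xi n k)"
  proof (rule sum_mono)
    fix k
    have "card {w \<in> ?N. ?d w = k} \<le> card {w \<in> B. ?d w = k}" using fin by (intro card_mono) auto
    also have "\<dots> \<le> max_sphere n B k" by (rule card_sphere_le[OF y])
    finally show "(\<Sum>w\<in>{w \<in> ?N. ?d w = k}. xi n (?d w)) \<le> real (max_sphere n B k) * xi n k"
      by (simp add: mult_right_mono xi_nonneg)
  qed
  also have "(\<Sum>w\<in>?F. xi n (?d w)) \<le> (\<Sum>w\<in>?F. xi n r)"
    using hdist_le by (intro sum_mono xi_antimono) auto
  also have "\<dots> = real (card ?F) * xi n r" by simp
  also have "\<dots> \<le> real (card B) * xi n r"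
    using fin by (intro mult_right_mono xi_nonneg of_nat_mono card_mono) auto
  also have "real (card (B - {y})) * ?c \<le> real (card B) * ?c"
    using fin by (intro mult_right_mono of_nat_mono card_mono) (auto simp: harm_nonneg)
  finally show ?thesis by simp
qed

text \<open>The error bound depends on \<open>B\<close> but not on \<open>x\<close> or \<open>t\<close>, which gives the uniformity in the starting
  point.\<close>

lemma hitting_time_geometric:
  assumes n: "n \<ge> 1" and B: "B \<subseteq> hypercube n" and x: "x \<in> hypercube n" and r: "r \<le> n"
  shows "\<bar>measure (srw_law n x) {\<omega>. ereal_of_enat (hitting_time (B - {x}) \<omega>) \<ge> ereal t}
      - (1 - cube_density n (B - {x})) ^ nat \<lceil>t\<rceil>\<bar>
    \<le> 2 * (real n * (1 - 1 / real n) ^ s + real (Suc s) * cube_density n B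
      + ((\<Sum>k\<in>{1..<r}. real (max_sphere n B k) * xi n k) + real (card B) * xi n r
        + real (card B) * (real n / 2 ^ Suc n * harm n))
      + (3 / real n + real n / 2 ^ Suc n * harm n))"
    (is "_ \<le> 2 * (?\<delta> + _ + ?\<rho> + ?\<epsilon>)")
proof -
  let ?A = "B - {x}"
  have fin: "finite B" using B finite_hypercube finite_subset by blast
  have A: "?A \<subseteq> hypercube n" using B by blast
  have "set_potential n (?A - {y}) y \<le> ?\<rho>" if "y \<in> insert x ?A" for y
  proof -
    have "set_potential n (?A - {y}) y \<le> set_potential n (B - {y}) y"
      unfolding set_potential_def using fin by (intro sum_mono2 potential_nonneg hdist_le) auto
    also have "\<dots> \<le> ?\<rho>" using that x A by (intro set_potential_le[OF B _ r]) auto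
    finally show ?thesis .
  qed
  from survival_geometric[OF n A x _ this, of "nat \<lceil>t\<rceil>" s]
  have "\<bar>survival n ?A (nat \<lceil>t\<rceil>) x - (1 - cube_density n ?A) ^ nat \<lceil>t\<rceil>\<bar> \<le>
      2 * (?\<delta> + real (Suc s) * cube_density n ?A + ?\<rho> + potential n 1)" by simp
  also have "\<dots> \<le> 2 * (?\<delta> + real (Suc s) * cube_density n B + ?\<rho> + ?\<epsilon>)"
  proof -
    have "card ?A \<le> card B" using fin by (intro card_mono) auto
    then have dens: "real (Suc s) * cube_density n ?A \<le> real (Suc s) * cube_density n B"
      unfolding cube_density_def by (intro mult_left_mono divide_right_mono of_nat_mono) auto
    have "potential n 1 \<le> ?\<epsilon>"
      using potential_le[of n 1] xi_1_le[OF n] by linarith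
    with dens show ?thesis
      by (intro mult_left_mono[OF add_mono[OF add_right_mono[OF add_left_mono]]]) simp_all
  qed
  finally show ?thesis by (simp only: measure_hitting_time_ge[OF n x])
qed

section \<open>Passage to the limit\<close>

text \<open>Only the product \<open>k * \<theta>\<close> enters, by the bounds \<open>exp (- \<theta> / (1 - \<theta>)) \<le> 1 - \<theta> \<le> exp (- \<theta>)\<close>.\<close>

lemma tendsto_one_minus_power_exp:
  fixes \<theta> :: "nat \<Rightarrow> real" and k :: "nat \<Rightarrow> nat"
  assumes \<theta>: "\<theta> \<longlonglongrightarrow> 0" and k\<theta>: "(\<lambda>n. real (k n) * \<theta> n) \<longlonglongrightarrow> a"
  shows "(\<lambda>n. (1 - \<theta> n) ^ k n) \<longlonglongrightarrow> exp (- a)"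
proof (rule tendsto_sandwich)
  have small: "eventually (\<lambda>n. \<theta> n < 1) sequentially"
    using \<theta> by (rule order_tendstoD) simp
  show "eventually (\<lambda>n. exp (- (real (k n) * \<theta> n / (1 - \<theta> n))) \<le> (1 - \<theta> n) ^ k n) sequentially"
    using small
  proof eventually_elim
    case (elim n)
    have "inverse (1 - \<theta> n) = 1 + \<theta> n / (1 - \<theta> n)" using elim by (simp add: field_simps)
    also have "\<dots> \<le> exp (\<theta> n / (1 - \<theta> n))" by (rule exp_ge_add_one_self)
    finally have "inverse (exp (\<theta> n / (1 - \<theta> n))) \<le> 1 - \<theta> n"
      using elim by (metis diff_gt_0_iff_gt inverse_inverse_eq le_imp_inverse_le positive_imp_inverse_positive)
    then have "exp (- (\<theta> n / (1 - \<theta> n))) ^ k n \<le> (1 - \<theta> n) ^ k n"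
      by (intro power_mono) (simp_all add: exp_minus)
    then show ?case by (simp flip: exp_of_nat_mult)
  qed
  show "eventually (\<lambda>n. (1 - \<theta> n) ^ k n \<le> exp (- (real (k n) * \<theta> n))) sequentially"
    using small
  proof eventually_elim
    case (elim n)
    have "(1 - \<theta> n) ^ k n \<le> exp (- \<theta> n) ^ k n"
      using exp_ge_add_one_self[of "- \<theta> n"] elim by (intro power_mono) auto
    then show ?case by (simp flip: exp_of_nat_mult)
  qed
  have "(\<lambda>n. exp (- (real (k n) * \<theta> n / (1 - \<theta> n)))) \<longlonglongrightarrow> exp (- (a / (1 - 0)))"
    by (intro tendsto_intros k\<theta> \<theta>) simp
  then show "(\<lambda>n. exp (- (real (k n) * \<theta> n / (1 - \<theta> n)))) \<longlonglongrightarrow> exp (- a)" by simp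
  show "(\<lambda>n. exp (- (real (k n) * \<theta> n))) \<longlonglongrightarrow> exp (- a)"
    by (intro tendsto_intros k\<theta>)
qed

text \<open>The mixing time \<open>2 n ln n\<close> brings the error of the mixing estimate down to \<open>1 / n\<close>.\<close>

lemma mixing_error_le:
  assumes n: "n \<ge> 1"
  shows "real n * (1 - 1 / real n) ^ nat \<lceil>2 * real n * ln (real n)\<rceil> \<le> 1 / real n"
proof -
  let ?s = "nat \<lceil>2 * real n * ln (real n)\<rceil>"
  have "(1 - 1 / real n) ^ ?s \<le> exp (- (1 / real n)) ^ ?s"
    using exp_ge_add_one_self[of "- (1 / real n)"] n by (intro power_mono) auto
  also have "\<dots> = exp (- (real ?s / real n))" by (simp flip: exp_of_nat_mult)
  also have "\<dots> \<le> exp (- (2 * ln (real n)))"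
  proof -
    have "2 * real n * ln (real n) \<le> real ?s" by (rule real_nat_ceiling_ge)
    then show ?thesis using n by (simp add: field_simps)
  qed
  also have "\<dots> = 1 / real n ^ 2" using n
    by (simp add: exp_minus inverse_eq_divide exp_double)
  finally have "real n * (1 - 1 / real n) ^ ?s \<le> real n * (1 / real n ^ 2)"
    by (rule mult_left_mono) simp
  then show ?thesis using n by (simp add: power2_eq_square)
qed

lemma harm_le_one_plus_ln: "n \<ge> 1 \<Longrightarrow> harm n \<le> 1 + ln (real n)"
  using euler_mascheroni_sequence_decreasing[of 1 n] by (simp add: harm_def)

theorem theorem1p3:
  fixes m :: "nat \<Rightarrow> real" and B :: "nat \<Rightarrow> vertex set"
  assumes "\<And>n. n \<ge> 1 \<Longrightarrow> 0 < m n"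
    and "(\<lambda>n. real n * ln (real n)) \<lless> m"
    and "\<And>n. n \<ge> 1 \<Longrightarrow> m n \<le> 2 ^ n"
    and "\<And>n. n \<ge> 1 \<Longrightarrow> B n \<subseteq> hypercube n"
    and "\<And>n. n \<ge> 1 \<Longrightarrow> 0 < card (B n)"
    and "(\<lambda>n. real (card (B n))) \<sim>[at_top] (\<lambda>n. 2 ^ n / m n)"
    and "\<exists>g :: nat \<Rightarrow> nat.
           (\<forall>n\<ge>1. real (g n) \<le> real n / 2) \<and>
           (\<lambda>n. xi n (g n)) \<lless> (\<lambda>n. m n / 2 ^ n) \<and>
           (\<lambda>n. \<Sum>k\<in>{1..<g n}. real (max_sphere n (B n) k) * xi n k) \<longlonglongrightarrow> 0 \<and>
           (\<lambda>n. real (max_ball n (B n) (int (g n) - 1))) \<lless> (\<lambda>n. real (card (B n)))"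
  shows "\<forall>a>0. (\<lambda>n. MAX x\<in>hypercube n.
           \<bar>measure (srw_law n x) {\<omega>. ereal_of_enat (hitting_time (B n - {x}) \<omega>) \<ge> ereal (a * m n)}
             - exp (- a)\<bar>) \<longlonglongrightarrow> 0"
proof (intro allI impI)
  fix a :: real assume a: "a > 0"
  note m_pos = assms(1) and m_le = assms(3) and B = assms(4) and B_pos = assms(5)
  obtain g :: "nat \<Rightarrow> nat" where g_half: "\<And>n. n \<ge> 1 \<Longrightarrow> real (g n) \<le> real n / 2"
    and xi_g: "(\<lambda>n. xi n (g n) / (m n / 2 ^ n)) \<longlonglongrightarrow> 0"
    and spheres: "(\<lambda>n. \<Sum>k\<in>{1..<g n}. real (max_sphere n (B n) k) * xi n k) \<longlonglongrightarrow> 0"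
    and ball: "(\<lambda>n. real (max_ball n (B n) (int (g n) - 1)) / real (card (B n))) \<longlonglongrightarrow> 0"
    using assms(7) unfolding much_less_def by blast
  have g_le: "g n \<le> n" if "n \<ge> 1" for n using g_half[OF that] by linarith
  have nlnn: "(\<lambda>n. real n * ln (real n) / m n) \<longlonglongrightarrow> 0"
    using assms(2) by (simp add: much_less_def)
  have ln_ge_1: "ln (real n) \<ge> 1" if "n \<ge> 3" for n
    using that exp_le by (subst ln_ge_iff) auto
  have n_m: "(\<lambda>n. real n / m n) \<longlonglongrightarrow> 0"
  proof (rule tendsto_sandwich[OF _ _ tendsto_const nlnn])
    show "eventually (\<lambda>n. 0 \<le> real n / m n) sequentially"
      using eventually_ge_at_top[of 1] by eventually_elim (use m_pos in \<open>simp add: less_imp_le\<close>)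
    show "eventually (\<lambda>n. real n / m n \<le> real n * ln (real n) / m n) sequentially"
      using eventually_ge_at_top[of 3]
    proof eventually_elim
      case (elim n)
      then show ?case using m_pos[of n] ln_ge_1[OF elim]
        by (intro divide_right_mono) (auto simp: mult_le_cancel_left1)
    qed
  qed
  have one_m: "(\<lambda>n. 1 / m n) \<longlonglongrightarrow> 0"
  proof (rule tendsto_sandwich[OF _ _ tendsto_const n_m])
    show "eventually (\<lambda>n. 0 \<le> 1 / m n) sequentially"
      using eventually_ge_at_top[of 1] by eventually_elim (use m_pos in \<open>simp add: less_imp_le\<close>)
    show "eventually (\<lambda>n. 1 / m n \<le> real n / m n) sequentially"
      using eventually_ge_at_top[of 1]
      by eventually_elim (use m_pos in \<open>intro divide_right_mono, auto simp: less_imp_le\<close>)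
  qed

  \<comment> \<open>The ratio of \<open>|B n|\<close> to its asymptotic size; thus \<open>b n / m n\<close> is the density of \<open>B n\<close>.\<close>
  define b where "b n = real (card (B n)) / (2 ^ n / m n)" for n
  have b_eq: "cube_density n (B n) = b n / m n" if "n \<ge> 1" for n
    using m_pos[OF that] by (simp add: b_def cube_density_def)
  have b: "b \<longlonglongrightarrow> 1"
  proof -
    have "(\<lambda>n. if real (card (B n)) = 0 \<and> 2 ^ n / m n = 0 then 1
        else real (card (B n)) / (2 ^ n / m n)) \<longlonglongrightarrow> 1"
      using assms(6) by (simp add: asymp_equiv_def)
    moreover have "eventually (\<lambda>n. (if real (card (B n)) = 0 \<and> 2 ^ n / m n = 0 then 1
        else real (card (B n)) / (2 ^ n / m n)) = b n) sequentially"
      using eventually_ge_at_top[of 1] by eventually_elim (use B_pos in \<open>auto simp: b_def\<close>)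
    ultimately show ?thesis by (rule Lim_transform_eventually)
  qed
  have density: "(\<lambda>n. b n / m n) \<longlonglongrightarrow> 0"
    using tendsto_mult[OF b one_m] by simp

  \<comment> \<open>If \<open>B n\<close> could be a singleton, then \<open>B n - {x}\<close> might be empty and would never be hit. Since
    \<open>\<xi>\<^sub>n(0)\<close> stays away from zero while \<open>m n \<le> 2 ^ n\<close>, the radius \<open>g n\<close> is eventually positive, and
    then every point of \<open>B n\<close> lies in a ball of radius \<open>g n - 1\<close>.\<close>
  have inv_card: "(\<lambda>n. 1 / real (card (B n))) \<longlonglongrightarrow> 0"
  proof (rule tendsto_sandwich[OF _ _ tendsto_const ball])
    show "eventually (\<lambda>n. 0 \<le> 1 / real (card (B n))) sequentially" by simp
    have "eventually (\<lambda>n. xi n (g n) / (m n / 2 ^ n) < 1 / 4) sequentially"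
      using xi_g by (rule order_tendstoD) simp
    then show "eventually (\<lambda>n. 1 / real (card (B n)) \<le>
        real (max_ball n (B n) (int (g n) - 1)) / real (card (B n))) sequentially"
      using eventually_ge_at_top[of 1]
    proof eventually_elim
      case (elim n)
      have "g n \<noteq> 0"
      proof
        assume "g n = 0"
        then have "1 / 4 \<le> xi n (g n)" using xi_0_ge[OF elim(2)] by simp
        also have "\<dots> \<le> xi n (g n) / (m n / 2 ^ n)"
          using m_pos[OF elim(2)] mult_left_mono[OF m_le[OF elim(2)] xi_nonneg[of n "g n"]]
          by (simp add: field_simps)
        finally show False using elim(1) by simp
      qed
      obtain x where x: "x \<in> B n" using B_pos[OF elim(2)] by fastforce
      have fin: "finite (B n)" using B[OF elim(2)] finite_hypercube finite_subset by blast
      let ?S = "\<lambda>x. {y \<in> B n. int (hdist n x y) \<le> int (g n) - 1}"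
      have "{x} \<subseteq> ?S x" using x \<open>g n \<noteq> 0\<close> by simp
      then have "card {x} \<le> card (?S x)" using fin by (intro card_mono) auto
      also have "\<dots> \<le> max_ball n (B n) (int (g n) - 1)"
        unfolding max_ball_def using x B[OF elim(2)] by (intro Max_ge) auto
      finally show ?case by (simp add: divide_right_mono)
    qed
  qed

  define e where "e n = 2 * (1 / real n
      + (2 * (real n * ln (real n) / m n) + 2 * (1 / m n)) * b n
      + ((\<Sum>k\<in>{1..<g n}. real (max_sphere n (B n) k) * xi n k)
        + b n * (xi n (g n) / (m n / 2 ^ n))
        + b n * (real n / m n + real n * ln (real n) / m n))
      + (3 * (1 / real n) + (real n / m n + real n * ln (real n) / m n)))" for n
  have e: "e \<longlonglongrightarrow> 0"
  proof -
    have "e \<longlonglongrightarrow> 2 * (0 + (2 * 0 + 2 * 0) * 1 + (0 + 1 * 0 + 1 * (0 + 0)) + (3 * 0 + (0 + 0)))"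
      unfolding e_def
      by (intro tendsto_add tendsto_mult tendsto_const lim_1_over_n nlnn n_m one_m b spheres xi_g)
    then show ?thesis by simp
  qed

  \<comment> \<open>The geometric laws for the densities of \<open>B n\<close> and of \<open>B n\<close> without one point, which enclose the
    one for \<open>B n - {x}\<close> uniformly in \<open>x\<close>.\<close>
  define p where "p n = (1 - b n / m n) ^ nat \<lceil>a * m n\<rceil>" for n
  define q where "q n = (1 - b n / m n * (1 - 1 / real (card (B n)))) ^ nat \<lceil>a * m n\<rceil>" for n
  have k_m: "(\<lambda>n. real (nat \<lceil>a * m n\<rceil>) * (1 / m n)) \<longlonglongrightarrow> a"
  proof (rule tendsto_sandwich[of "\<lambda>_. a" _ _ "\<lambda>n. a + 1 / m n"])
    have "real (nat \<lceil>a * m n\<rceil>) \<ge> a * m n \<and> real (nat \<lceil>a * m n\<rceil>) \<le> a * m n + 1" if "n \<ge> 1" for n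
      using mult_pos_pos[OF a m_pos[OF that]] by linarith
    then have "a \<le> real (nat \<lceil>a * m n\<rceil>) * (1 / m n) \<and> real (nat \<lceil>a * m n\<rceil>) * (1 / m n) \<le> a + 1 / m n"
      if "n \<ge> 1" for n
      using that m_pos[OF that] by (simp add: field_simps)
    then show "eventually (\<lambda>n. a \<le> real (nat \<lceil>a * m n\<rceil>) * (1 / m n)) sequentially"
      "eventually (\<lambda>n. real (nat \<lceil>a * m n\<rceil>) * (1 / m n) \<le> a + 1 / m n) sequentially"
      by (auto intro: eventually_mono[OF eventually_ge_at_top[of 1]])
    show "(\<lambda>n. a + 1 / m n) \<longlonglongrightarrow> a" using tendsto_add[OF tendsto_const one_m, of a] by simp
  qed simp
  have k_density: "(\<lambda>n. real (nat \<lceil>a * m n\<rceil>) * (b n / m n)) \<longlonglongrightarrow> a"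
    using tendsto_mult[OF k_m b] by (simp add: mult_ac)
  have p: "p \<longlonglongrightarrow> exp (- a)"
    unfolding p_def by (rule tendsto_one_minus_power_exp[OF density k_density])
  have q: "q \<longlonglongrightarrow> exp (- a)"
    unfolding q_def
  proof (rule tendsto_one_minus_power_exp)
    have c: "(\<lambda>n. 1 - 1 / real (card (B n))) \<longlonglongrightarrow> 1"
      using tendsto_diff[OF tendsto_const inv_card, of 1] by simp
    show "(\<lambda>n. b n / m n * (1 - 1 / real (card (B n)))) \<longlonglongrightarrow> 0"
      using tendsto_mult[OF density c] by simp
    show "(\<lambda>n. real (nat \<lceil>a * m n\<rceil>) * (b n / m n * (1 - 1 / real (card (B n))))) \<longlonglongrightarrow> a"
      using tendsto_mult[OF k_density c] by (simp add: mult.assoc)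
  qed

  have bound: "\<bar>measure (srw_law n x)
        {\<omega>. ereal_of_enat (hitting_time (B n - {x}) \<omega>) \<ge> ereal (a * m n)} - exp (- a)\<bar>
      \<le> e n + (\<bar>p n - exp (- a)\<bar> + \<bar>q n - exp (- a)\<bar>)"
    if n: "n \<ge> 1" and x: "x \<in> hypercube n" for n x
  proof -
    let ?k = "nat \<lceil>a * m n\<rceil>" and ?s = "nat \<lceil>2 * real n * ln (real n)\<rceil>"
    let ?\<theta> = "cube_density n (B n - {x})"
    have mp: "m n > 0" and bp: "b n \<ge> 0" using m_pos[OF n] by (simp_all add: b_def)
    have fin: "finite (B n)" using B[OF n] finite_hypercube finite_subset by blast
    have harm: "real n * harm n \<le> real n + real n * ln (real n)"
      using mult_left_mono[OF harm_le_one_plus_ln[OF n], of "real n"] by (simp add: distrib_left)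
    have "\<bar>measure (srw_law n x) {\<omega>. ereal_of_enat (hitting_time (B n - {x}) \<omega>) \<ge> ereal (a * m n)}
        - (1 - ?\<theta>) ^ ?k\<bar>
      \<le> 2 * (real n * (1 - 1 / real n) ^ ?s + real (Suc ?s) * cube_density n (B n)
        + ((\<Sum>k\<in>{1..<g n}. real (max_sphere n (B n) k) * xi n k) + real (card (B n)) * xi n (g n)
          + real (card (B n)) * (real n / 2 ^ Suc n * harm n))
        + (3 / real n + real n / 2 ^ Suc n * harm n))"
      by (rule hitting_time_geometric[OF n B[OF n] x g_le[OF n]])
    also have "\<dots> \<le> e n"
      unfolding e_def
    proof (intro mult_left_mono add_mono order_refl mixing_error_le[OF n])
      have "real (Suc ?s) \<le> 2 * real n * ln (real n) + 2"
      proof -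
        have "real ?s = of_int \<lceil>2 * real n * ln (real n)\<rceil>" using n by simp
        then show ?thesis
          using of_int_ceiling_le_add_one[of "2 * real n * ln (real n)"] by linarith
      qed
      then have "real (Suc ?s) * (b n / m n) \<le> (2 * real n * ln (real n) + 2) * (b n / m n)"
        using mp bp by (intro mult_right_mono) auto
      also have "\<dots> = (2 * (real n * ln (real n) / m n) + 2 * (1 / m n)) * b n"
        by (simp add: algebra_simps add_divide_distrib)
      finally show "real (Suc ?s) * cube_density n (B n) \<le>
          (2 * (real n * ln (real n) / m n) + 2 * (1 / m n)) * b n"
        by (simp only: b_eq[OF n])
      show "real (card (B n)) * xi n (g n) \<le> b n * (xi n (g n) / (m n / 2 ^ n))"
        using mp by (simp add: b_def)
      have "real (card (B n)) * (real n / 2 ^ Suc n * harm n) = b n * (real n * harm n / m n) / 2"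
        using mp by (simp add: b_def)
      also have "\<dots> \<le> b n * (real n * harm n / m n)"
      proof -
        have "b n * (real n * harm n / m n) \<ge> 0" using mp bp by (simp add: harm_nonneg)
        moreover have "y / 2 \<le> y" if "y \<ge> 0" for y :: real using that by simp
        ultimately show ?thesis by blast
      qed
      also have "\<dots> \<le> b n * (real n / m n + real n * ln (real n) / m n)"
        using mp bp harm by (intro mult_left_mono) (simp_all add: divide_right_mono flip: add_divide_distrib)
      finally show "real (card (B n)) * (real n / 2 ^ Suc n * harm n) \<le>
          b n * (real n / m n + real n * ln (real n) / m n)" .
      have "real n / 2 ^ Suc n * harm n \<le> real n * harm n / 2 ^ n"
        by (simp add: field_simps harm_nonneg)
      also have "\<dots> \<le> real n * harm n / m n"
        using m_le[OF n] mp by (intro divide_left_mono) (auto simp: harm_nonneg)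
      also have "\<dots> \<le> real n / m n + real n * ln (real n) / m n"
        using mp harm by (simp add: divide_right_mono flip: add_divide_distrib)
      finally show "real n / 2 ^ Suc n * harm n \<le> real n / m n + real n * ln (real n) / m n" .
    qed simp_all
    finally have geom: "\<bar>measure (srw_law n x)
        {\<omega>. ereal_of_enat (hitting_time (B n - {x}) \<omega>) \<ge> ereal (a * m n)} - (1 - ?\<theta>) ^ ?k\<bar> \<le> e n" .
    have \<theta>_le: "?\<theta> \<le> b n / m n"
      using fin unfolding b_eq[OF n, symmetric] cube_density_def
      by (intro divide_right_mono of_nat_mono card_mono) auto
    have \<theta>_ge: "b n / m n * (1 - 1 / real (card (B n))) \<le> ?\<theta>"
    proof -
      have "real (card (B n)) - 1 \<le> real (card (B n - {x}))"
        using fin B_pos[OF n] by (auto simp: card_Diff_singleton_if of_nat_diff)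
      then have "(real (card (B n)) - 1) / 2 ^ n \<le> ?\<theta>"
        by (simp add: cube_density_def divide_right_mono)
      moreover have "b n / m n * (1 - 1 / real (card (B n))) = (real (card (B n)) - 1) / 2 ^ n"
        using B_pos[OF n] by (simp add: right_diff_distrib diff_divide_distrib cube_density_def flip: b_eq[OF n])
      ultimately show ?thesis by simp
    qed
    have "p n \<le> (1 - ?\<theta>) ^ ?k"
      unfolding p_def using \<theta>_le cube_density_bounds[OF B[OF n]]
      by (intro power_mono) (auto simp flip: b_eq[OF n])
    moreover have "(1 - ?\<theta>) ^ ?k \<le> q n"
      unfolding q_def using \<theta>_ge cube_density_bounds(2)[of "B n - {x}" n] B[OF n]
      by (intro power_mono) auto
    ultimately show ?thesis using geom by linarith
  qed

  show "(\<lambda>n. MAX x\<in>hypercube n. \<bar>measure (srw_law n x)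
      {\<omega>. ereal_of_enat (hitting_time (B n - {x}) \<omega>) \<ge> ereal (a * m n)} - exp (- a)\<bar>) \<longlonglongrightarrow> 0"
    (is "(\<lambda>n. Max (?f n ` _)) \<longlonglongrightarrow> 0")
  proof (rule tendsto_sandwich[OF _ _ tendsto_const])
    have "0 \<le> Max (?f n ` hypercube n)" for n
    proof -
      obtain x where "x \<in> hypercube n" using hypercube_nonempty by blast
      then have "?f n x \<le> Max (?f n ` hypercube n)" by (intro Max_ge) auto
      then show ?thesis by linarith
    qed
    then show "eventually (\<lambda>n. 0 \<le> Max (?f n ` hypercube n)) sequentially" by simp
    show "eventually (\<lambda>n. Max (?f n ` hypercube n)
        \<le> e n + (\<bar>p n - exp (- a)\<bar> + \<bar>q n - exp (- a)\<bar>)) sequentially"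
      using eventually_ge_at_top[of 1]
      by eventually_elim (intro Max.boundedI, use bound in auto)
    have "(\<lambda>n. \<bar>p n - exp (- a)\<bar>) \<longlonglongrightarrow> 0" "(\<lambda>n. \<bar>q n - exp (- a)\<bar>) \<longlonglongrightarrow> 0"
      using p q by (simp_all add: LIM_zero tendsto_rabs_zero)
    then show "(\<lambda>n. e n + (\<bar>p n - exp (- a)\<bar> + \<bar>q n - exp (- a)\<bar>)) \<longlonglongrightarrow> 0"
      using tendsto_add[OF e tendsto_add] by fastforce
  qed
qed

end
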